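(* Let $E\in\mathbb{R}^{2n\times 4n}$ and $\mathbf{F}\in L_2^{2n\times n}[a,b]$, and let $$X:=\Big\{\mathbf{u}\in W_2^{2,n}[a,b]\ \Big|\ E\begin{bmatrix}\mathbf{u}(a)\\ \mathbf{u}(b)\\ \mathbf{u}_x(a)\\ \mathbf{u}_x(b)\end{bmatrix}+\int_a^b\mathbf{F}(x)\mathbf{u}(x)\,dx=0\Big\}.$$ Let $0\le m\le 2n$ and let $J\in\mathbb{R}^{2n\times 2n}$ be invertible such that, writing $JE=\begin{bmatrix}E_1\\ E_2\end{bmatrix}$ and $J\mathbf{F}=\begin{bmatrix}\mathbf{F}_1\\ \mathbf{F}_2\end{bmatrix}$ with $E_1,\mathbf{F}_1$ the first $2n-m$ rows and $E_2,\mathbf{F}_2$ the last $m$ rows, the matrix $G_{E_1,\mathbf{F}_1}\in\mathbb{R}^{(2n-m)\times 2n}$ has full row rank and $G_{E_2,\mathbf{F}_2}=0_{m\times 2n}$. Define $$Y:=\Big\{\begin{bmatrix}v_0\\ \mathbf{v}_1\end{bmatrix}\in\mathbb{R}^m\times L_2^n[a,b]\ \Big|\ \int_a^b\mathbf{H}_{E_2,\mathbf{F}_2}(x)\mathbf{v}_1(x)\,dx=0\Big\}.$$ Let $\mathbf{F}_3\in L_2^{m\times n}[a,b]$ be such that $\hat G:=G_{\left[\begin{smallmatrix}E_1\\ 0\end{smallmatrix}\right],\left[\begin{smallmatrix}\mathbf{F}_1\\ \mathbf{F}_3\end{smallmatrix}\right]}\in\mathbb{R}^{2n\times 2n}$ is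 invertible, and put $\hat{\mathbf{H}}:=\mathbf{H}_{\left[\begin{smallmatrix}E_1\\ 0\end{smallmatrix}\right],\left[\begin{smallmatrix}\mathbf{F}_1\\ \mathbf{F}_3\end{smallmatrix}\right]}$ (with $0=0_{m\times 4n}$). Define $$\mathbf{T}_0(x):=\begin{bmatrix}I_n&(x-a)I_n\end{bmatrix}\hat G^{-1}\begin{bmatrix}0_{(2n-m)\times m}\\ I_m\end{bmatrix},\qquad \mathbf{T}_1(x,\theta):=\begin{bmatrix}I_n&(x-a)I_n\end{bmatrix}\hat G^{-1}\hat{\mathbf{H}}(\theta),$$ $$(\mathcal{T}_0v_0)(x):=\mathbf{T}_0(x)v_0,\qquad (\mathcal{T}_1\mathbf{v}_1)(x):=\int_a^b\mathbf{T}_1(x,\theta)\mathbf{v}_1(\theta)\,d\theta+\int_a^x(x-\theta)\mathbf{v}_1(\theta)\,d\theta,\qquad \mathcal{F}\mathbf{u}:=\int_a^b\mathbf{F}_3(x)\mathbf{u}(x)\,dx.$$ Finally, let $\mathscr{D}\mathbf{u}:=\begin{bmatrix}\mathcal{F}\mathbf{u}\\ \partial_x^2\mathbf{u}\end{bmatrix}$ and $\mathcal{T}\mathbf{v}:=\mathcal{T}_0v_0+\mathcal{T}_1\mathbf{v}_1$ for $\mathbf{v}=\begin{bmatrix}v_0\\ \mathbf{v}_1\end{bmatrix}\in\mathbb{R}^m\times L_2^n[a,b]$. Then: 1. For every $\mathbf{u}\in X$, $\mathscr{D}\mathbf{u}\in Y$ and $\mathbf{u}=\mathcal{T}\mathscr{D}\mathbf{u}$.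 2. For every $\mathbf{v}\in Y$, $\mathcal{T}\mathbf{v}\in X$ and $\mathbf{v}=\mathscr{D}\mathcal{T}\mathbf{v}$.
   Context: $[a,b]\subset\mathbb{R}$ is a fixed interval with $a<b$, and $n\ge1$ is an integer. $L_2^n[a,b]$ (resp. $L_2^{m\times n}[a,b]$) is the space of square-integrable $\mathbb{R}^n$-valued (resp. $\mathbb{R}^{m\times n}$-valued) functions on $[a,b]$. $W_2^{2,n}[a,b]:=\{\mathbf{u}\in L_2^n[a,b]\mid \mathbf{u}_x,\mathbf{u}_{xx}\in L_2^n[a,b]\}$, where $\mathbf{u}_x=\partial_x\mathbf{u}$, $\mathbf{u}_{xx}=\partial_x^2\mathbf{u}$; point values $\mathbf{u}(a),\mathbf{u}(b),\mathbf{u}_x(a),\mathbf{u}_x(b)$ are those of the continuous representatives. For $E\in\mathbb{R}^{k\times 4n}$ and $\mathbf{F}\in L_2^{k\times n}[a,b]$ (any number of rows $k$), define $G_{E,\mathbf{F}}\in\mathbb{R}^{k\times 2n}$ and $\mathbf{H}_{E,\mathbf{F}}\in L_2^{k\times n}[a,b]$ by $$G_{E,\mathbf{F}}:=E\begin{bmatrix}I_n&0_n\\ I_n&(b-a)I_n\\ 0_n&I_n\\ 0_n&I_n\end{bmatrix}+\int_a^b\mathbf{F}(x)\begin{bmatrix}I_n&(x-a)I_n\end{bmatrix}dx,\qquad \mathbf{H}_{E,\mathbf{F}}(x):=-E\begin{bmatrix}0_n\\ (b-x)I_n\\ 0_n\\ I_n\end{bmatrix}-\int_x^b(\theta-x)\mathbf{F}(\theta)\,d\theta.$$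 Blocks with zero rows or columns are understood to be empty. *)

theory Defs
  imports
    "HOL-Analysis.Analysis"
    "Jordan_Normal_Form.Matrix"
    "Jordan_Normal_Form.Gauss_Jordan_Elimination"
    "Jordan_Normal_Form.DL_Rank"
begin

unbundle no vec_syntax
hide_const (open) Finite_Cartesian_Product.vec
no_notation inner (infix "\<bullet>" 70)

text \<open>
  Vectors and matrices are those of \<open>Jordan_Normal_Form\<close>, whose dimensions are natural numbers
  that may be zero. Elements of the spaces below are representatives of classes modulo equality
  almost everywhere on \<open>{a..b}\<close>; every operation that follows depends only on the classes.
\<close>

section \<open>Square integrable functions\<close>

definition L2 :: "real \<Rightarrow> real \<Rightarrow> (real \<Rightarrow> real) set" where
  "L2 a b = {f. f \<in> borel_measurable (lebesgue_on {a..b}) \<and>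
                integrable (lebesgue_on {a..b}) (\<lambda>x. (f x)\<^sup>2)}"

definition L2_vec :: "real \<Rightarrow> real \<Rightarrow> nat \<Rightarrow> (real \<Rightarrow> real vec) set" where
  "L2_vec a b n = {f. (\<forall>x\<in>{a..b}. f x \<in> carrier_vec n) \<and> (\<forall>i<n. (\<lambda>x. f x $ i) \<in> L2 a b)}"

definition L2_mat :: "real \<Rightarrow> real \<Rightarrow> nat \<Rightarrow> nat \<Rightarrow> (real \<Rightarrow> real mat) set" where
  "L2_mat a b k l = {F. (\<forall>x\<in>{a..b}. F x \<in> carrier_mat k l) \<and>
                        (\<forall>i<k. \<forall>j<l. (\<lambda>x. F x $$ (i, j)) \<in> L2 a b)}"

definition vec_integral :: "nat \<Rightarrow> real \<Rightarrow> real \<Rightarrow> (real \<Rightarrow> real vec) \<Rightarrow> real vec" where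
  "vec_integral k a b f = vec k (\<lambda>i. LINT x|lebesgue_on {a..b}. f x $ i)"

definition mat_integral :: "nat \<Rightarrow> nat \<Rightarrow> real \<Rightarrow> real \<Rightarrow> (real \<Rightarrow> real mat) \<Rightarrow> real mat" where
  "mat_integral k l a b F = mat k l (\<lambda>(i, j). LINT x|lebesgue_on {a..b}. F x $$ (i, j))"

section \<open>Weak derivatives and Sobolev functions\<close>

text \<open>Real functions on the line that are \<open>C\<^sup>\<infinity>\<close> with compact support inside \<open>{a<..<b}\<close>.\<close>

definition test_functions :: "real \<Rightarrow> real \<Rightarrow> (real \<Rightarrow> real) set" where
  "test_functions a b = {\<phi>. (\<forall>k. (deriv ^^ k) \<phi> differentiable_on UNIV) \<and>
                            closure {x. \<phi> x \<noteq> 0} \<subseteq> {a<..<b}}"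

definition has_weak_deriv :: "real \<Rightarrow> real \<Rightarrow> (real \<Rightarrow> real) \<Rightarrow> (real \<Rightarrow> real) \<Rightarrow> bool" where
  "has_weak_deriv a b f g \<longleftrightarrow>
     integrable (lebesgue_on {a..b}) f \<and> integrable (lebesgue_on {a..b}) g \<and>
     (\<forall>\<phi>\<in>test_functions a b.
        (LINT x|lebesgue_on {a..b}. f x * deriv \<phi> x) = - (LINT x|lebesgue_on {a..b}. g x * \<phi> x))"

text \<open>The weak derivative is determined only almost everywhere, so this picks a representative.\<close>

definition weak_deriv :: "real \<Rightarrow> real \<Rightarrow> (real \<Rightarrow> real) \<Rightarrow> real \<Rightarrow> real" where
  "weak_deriv a b f = (SOME g. has_weak_deriv a b f g)"

definition weak_deriv_vec :: "real \<Rightarrow> real \<Rightarrow> nat \<Rightarrow> (real \<Rightarrow> real vec) \<Rightarrow> real \<Rightarrow> real vec" where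
  "weak_deriv_vec a b n u = (\<lambda>x. vec n (\<lambda>i. weak_deriv a b (\<lambda>y. u y $ i) x))"

definition has_weak_deriv_vec ::
  "real \<Rightarrow> real \<Rightarrow> nat \<Rightarrow> (real \<Rightarrow> real vec) \<Rightarrow> (real \<Rightarrow> real vec) \<Rightarrow> bool" where
  "has_weak_deriv_vec a b n u w \<longleftrightarrow>
     (\<forall>i<n. has_weak_deriv a b (\<lambda>x. u x $ i) (\<lambda>x. w x $ i))"

definition W2 :: "real \<Rightarrow> real \<Rightarrow> nat \<Rightarrow> (real \<Rightarrow> real vec) set" where
  "W2 a b n = {u \<in> L2_vec a b n. \<exists>ux\<in>L2_vec a b n. \<exists>uxx\<in>L2_vec a b n.
                 has_weak_deriv_vec a b n u ux \<and> has_weak_deriv_vec a b n ux uxx}"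

text \<open>On \<open>{a..b}\<close> the continuous representative, if there is one, is unique.\<close>

definition cont_rep :: "real \<Rightarrow> real \<Rightarrow> (real \<Rightarrow> real) \<Rightarrow> real \<Rightarrow> real" where
  "cont_rep a b f = (SOME g. continuous_on {a..b} g \<and> (AE x in lebesgue_on {a..b}. f x = g x))"

definition point_value :: "real \<Rightarrow> real \<Rightarrow> nat \<Rightarrow> (real \<Rightarrow> real vec) \<Rightarrow> real \<Rightarrow> real vec" where
  "point_value a b n u x = vec n (\<lambda>i. cont_rep a b (\<lambda>y. u y $ i) x)"

definition boundary_values :: "real \<Rightarrow> real \<Rightarrow> nat \<Rightarrow> (real \<Rightarrow> real vec) \<Rightarrow> real vec" where
  "boundary_values a b n u =
     point_value a b n u a @\<^sub>v point_value a b n u b @\<^sub>v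
     point_value a b n (weak_deriv_vec a b n u) a @\<^sub>v
     point_value a b n (weak_deriv_vec a b n u) b"

section \<open>The matrices \<open>G\<close> and \<open>H\<close>\<close>

definition append_cols :: "real mat \<Rightarrow> real mat \<Rightarrow> real mat" (infixr "@\<^sub>c" 66) where
  "A @\<^sub>c B = four_block_mat A B (0\<^sub>m 0 (dim_col A)) (0\<^sub>m 0 (dim_col B))"

definition affine_row :: "real \<Rightarrow> nat \<Rightarrow> real \<Rightarrow> real mat" where
  "affine_row a n x = 1\<^sub>m n @\<^sub>c ((x - a) \<cdot>\<^sub>m 1\<^sub>m n)"

definition G_mat :: "real \<Rightarrow> real \<Rightarrow> nat \<Rightarrow> real mat \<Rightarrow> (real \<Rightarrow> real mat) \<Rightarrow> real mat" where
  "G_mat a b n E F =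
     E * ((1\<^sub>m n @\<^sub>c 0\<^sub>m n n) @\<^sub>r
          (1\<^sub>m n @\<^sub>c ((b - a) \<cdot>\<^sub>m 1\<^sub>m n)) @\<^sub>r
          (0\<^sub>m n n @\<^sub>c 1\<^sub>m n) @\<^sub>r
          (0\<^sub>m n n @\<^sub>c 1\<^sub>m n))
     + mat_integral (dim_row E) (2 * n) a b (\<lambda>x. F x * affine_row a n x)"

definition H_mat :: "real \<Rightarrow> nat \<Rightarrow> real mat \<Rightarrow> (real \<Rightarrow> real mat) \<Rightarrow> real \<Rightarrow> real mat" where
  "H_mat b n E F x =
     - (E * (0\<^sub>m n n @\<^sub>r ((b - x) \<cdot>\<^sub>m 1\<^sub>m n) @\<^sub>r 0\<^sub>m n n @\<^sub>r 1\<^sub>m n))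
     - mat_integral (dim_row E) n x b (\<lambda>\<theta>. (\<theta> - x) \<cdot>\<^sub>m F \<theta>)"

section \<open>The spaces \<open>X\<close>, \<open>Y\<close> and the operators between them\<close>

definition space_X :: "real \<Rightarrow> real \<Rightarrow> nat \<Rightarrow> real mat \<Rightarrow> (real \<Rightarrow> real mat) \<Rightarrow> (real \<Rightarrow> real vec) set"
  where
  "space_X a b n E F =
     {u \<in> W2 a b n. E *\<^sub>v boundary_values a b n u + vec_integral (dim_row E) a b (\<lambda>x. F x *\<^sub>v u x)
                    = 0\<^sub>v (dim_row E)}"

definition space_Y ::
  "real \<Rightarrow> real \<Rightarrow> nat \<Rightarrow> nat \<Rightarrow> real mat \<Rightarrow> (real \<Rightarrow> real mat) \<Rightarrow> (real vec \<times> (real \<Rightarrow> real vec)) set"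
  where
  "space_Y a b n m E2 F2 =
     {(v0, v1). v0 \<in> carrier_vec m \<and> v1 \<in> L2_vec a b n \<and>
                vec_integral m a b (\<lambda>x. H_mat b n E2 F2 x *\<^sub>v v1 x) = 0\<^sub>v m}"

definition op_D ::
  "real \<Rightarrow> real \<Rightarrow> nat \<Rightarrow> nat \<Rightarrow> (real \<Rightarrow> real mat) \<Rightarrow> (real \<Rightarrow> real vec) \<Rightarrow> real vec \<times> (real \<Rightarrow> real vec)"
  where
  "op_D a b n m F3 u =
     (vec_integral m a b (\<lambda>x. F3 x *\<^sub>v u x), weak_deriv_vec a b n (weak_deriv_vec a b n u))"

text \<open>\<open>mat_inverse\<close> returns an option; this is the inverse of an invertible square matrix.\<close>

definition mat_inv :: "real mat \<Rightarrow> real mat" where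
  "mat_inv A = the (mat_inverse A)"

definition T0_kernel :: "real \<Rightarrow> nat \<Rightarrow> nat \<Rightarrow> real mat \<Rightarrow> real \<Rightarrow> real mat" where
  "T0_kernel a n m G x = affine_row a n x * mat_inv G * (0\<^sub>m (2 * n - m) m @\<^sub>r 1\<^sub>m m)"

definition T1_kernel :: "real \<Rightarrow> nat \<Rightarrow> real mat \<Rightarrow> (real \<Rightarrow> real mat) \<Rightarrow> real \<Rightarrow> real \<Rightarrow> real mat" where
  "T1_kernel a n G H x \<theta> = affine_row a n x * mat_inv G * H \<theta>"

definition op_T0 :: "real \<Rightarrow> nat \<Rightarrow> nat \<Rightarrow> real mat \<Rightarrow> real vec \<Rightarrow> real \<Rightarrow> real vec" where
  "op_T0 a n m G v0 x = T0_kernel a n m G x *\<^sub>v v0"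

definition op_T1 ::
  "real \<Rightarrow> real \<Rightarrow> nat \<Rightarrow> real mat \<Rightarrow> (real \<Rightarrow> real mat) \<Rightarrow> (real \<Rightarrow> real vec) \<Rightarrow> real \<Rightarrow> real vec" where
  "op_T1 a b n G H v1 x =
     vec_integral n a b (\<lambda>\<theta>. T1_kernel a n G H x \<theta> *\<^sub>v v1 \<theta>)
     + vec_integral n a x (\<lambda>\<theta>. (x - \<theta>) \<cdot>\<^sub>v v1 \<theta>)"

definition op_T ::
  "real \<Rightarrow> real \<Rightarrow> nat \<Rightarrow> nat \<Rightarrow> real mat \<Rightarrow> (real \<Rightarrow> real mat)
     \<Rightarrow> real vec \<times> (real \<Rightarrow> real vec) \<Rightarrow> real \<Rightarrow> real vec" where
  "op_T a b n m G H v x = op_T0 a n m G (fst v) x + op_T1 a b n G H (snd v) x"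

end

theory Submission imports Defs begin

text \<open>
  A function lies in \<open>W2\<close> iff almost everywhere \<open>u(x) = c0 + (x - a) c1 + \<integral>\<^sub>a\<^sup>x (x - t) w(t) dt\<close> with \<open>w\<close>
  square integrable; then \<open>w\<close> is the second weak derivative. Substituting this into a constraint and
  exchanging the order of integration over the triangle \<open>t \<le> x\<close> gives, for every \<open>E\<close> and \<open>F\<close>, the identity
  \<open>E z + \<integral> F u = G (c0, c1) - \<integral> H w\<close>, where \<open>z\<close> are the boundary values of \<open>u\<close>.
  For \<open>(E2, F2)\<close>, where \<open>G = 0\<close>, it says that the constraint on \<open>u\<close> is the constraint on \<open>w\<close> defining \<open>Y\<close>.
  For the augmented pair, where \<open>G\<close> is invertible, it determines \<open>(c0, c1)\<close> from \<open>\<integral> F3 u\<close> and \<open>w\<close>, which is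
  exactly the formula for \<open>T\<close>.
\<close>

section \<open>Smooth bump functions\<close>

text \<open>Weak derivatives are known only through pairings with test functions. The representation
  of \<open>W2\<close> therefore rests on a supply of concrete test functions rich enough to
  separate integrable functions, and on the lemma of du Bois-Reymond: weak derivative zero implies
  constant almost everywhere. A second obstacle is that \<open>weak_deriv\<close> and
  \<open>cont_rep\<close> are arbitrary choices. Each use is traded for an explicit primitive, which
  fixes a weak derivative almost everywhere and a continuous representative everywhere. Boundary
  values thereby become an explicit vector in c0, c1 and w before any matrix algebra starts. After
  that every constraint is a value of one linear expression, the residual, which respects stacking
  of rows and multiplication by J. So u lies in X exactly when the residuals of (E1, F1) and (E2,
  F2) both vanish. The augmented pair has (0, F3) as its lower block: its residual consists of the
  (E1, F1) residual, zero on X, and of the value of the integral of F3 u. This is the origin of the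
  vector (0, v0) to which the inverse of G is applied.\<close>

definition smooth :: "(real \<Rightarrow> real) \<Rightarrow> bool" where
  "smooth f \<longleftrightarrow> (\<forall>k. (deriv ^^ k) f differentiable_on UNIV)"

text \<open>Iterated derivatives never leave a family closed under differentiation, so a single
  derivative step suffices and no formula for the k-th derivative is required.\<close>

lemma smooth_coinduct:
  assumes "f \<in> S"
    and step: "\<And>f. f \<in> S \<Longrightarrow> \<exists>f'\<in>S. \<forall>x. (f has_real_derivative f' x) (at x)"
  shows "smooth f"
proof -
  have "(deriv ^^ k) f \<in> S" for k
  proof (induction k)
    case (Suc k)
    obtain f' where f': "f' \<in> S" "\<forall>x. ((deriv ^^ k) f has_real_derivative f' x) (at x)"
      using step[OF Suc.IH] by blast
    have "deriv ((deriv ^^ k) f) = f'" using f'(2) by (auto intro!: DERIV_imp_deriv)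
    then show ?case using f'(1) by simp
  qed (use assms in simp)
  then show ?thesis unfolding smooth_def differentiable_on_def
    using step real_differentiable_def by blast
qed

text \<open>Serves the lemma of du Bois-Reymond, where the primitive of a smooth function of mean
  zero must be recognised as a test function.\<close>

lemma smooth_antideriv:
  assumes "\<And>x. (f has_real_derivative f' x) (at x)" "smooth f'"
  shows "smooth f"
proof -
  have d: "deriv f = f'" using assms(1) by (auto intro!: DERIV_imp_deriv)
  have "(deriv ^^ k) f differentiable_on UNIV" for k
  proof (cases k)
    case 0
    then show ?thesis using assms(1) 
      by (auto simp: differentiable_on_def real_differentiable_def)
  next
    case (Suc j)
    then have "(deriv ^^ k) f = (deriv ^^ j) f'" using d by (simp only: funpow_Suc_right o_apply)
    then show ?thesis using assms(2) by (simp add: smooth_def)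
  qed
  then show ?thesis by (auto simp: smooth_def)
qed

text \<open>
  Every derivative of \<open>x \<mapsto> exp (- 1 / x)\<close> is a polynomial in \<open>1 / x\<close> times \<open>exp (- 1 / x)\<close>, so this family
  is closed under differentiation, also at the gluing point \<open>0\<close>.
\<close>

definition flat :: "real poly \<Rightarrow> real \<Rightarrow> real" where
  "flat p x = (if x > 0 then poly p (1 / x) * exp (- (1 / x)) else 0)"

lemma poly_times_exp_minus_tendsto_0: "((\<lambda>y::real. poly p y * exp (- y)) \<longlongrightarrow> 0) at_top"
proof -
  have "((\<lambda>y. \<Sum>i\<le>degree p. coeff p i * (y ^ i / exp y)) \<longlongrightarrow> (\<Sum>i\<le>degree p. coeff p i * 0)) at_top"
    by (intro tendsto_intros tendsto_power_div_exp_0)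
  then show ?thesis
    by (simp add: poly_altdef sum_distrib_right exp_minus field_simps sum_divide_distrib)
qed

text \<open>With y = 1/x, differentiating p(y) exp(-y) in x gives y^2 (p(y) - p'(y)) exp(-y), which
  explains the polynomial \<open>[:0, 0, 1:] * (p - pderiv p)\<close>.\<close>

lemma flat_has_derivative:
  "(flat p has_real_derivative flat ([:0, 0, 1:] * (p - pderiv p)) x) (at x)"
proof (cases x "0::real" rule: linorder_cases)
  case less
  have "((\<lambda>_. 0) has_real_derivative 0) (at x)" by simp
  then show ?thesis
    by (rule DERIV_cong_ev[THEN iffD1, rotated 3])
       (use less in \<open>auto simp: flat_def intro!: eventually_mono[OF eventually_nhds_in_open[of "{..<0}"]]\<close>)
next
  case greater
  have "((\<lambda>x. poly p (1 / x) * exp (- (1 / x))) has_real_derivative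
        flat ([:0, 0, 1:] * (p - pderiv p)) x) (at x)"
    using greater
    by (auto intro!: derivative_eq_intros simp: flat_def field_simps power2_eq_square)
  then show ?thesis
    by (rule DERIV_cong_ev[THEN iffD1, rotated 3])
       (use greater in \<open>auto simp: flat_def intro!: eventually_mono[OF eventually_nhds_in_open[of "{0<..}"]]\<close>)
next
  case equal
  \<comment> \<open>The right difference quotient at 0 is p(1/h) exp(-1/h) / h; the factor 1/h is
    absorbed by multiplying p by its variable.\<close>
  have "((\<lambda>h. poly ([:0, 1:] * p) (inverse h) * exp (- inverse h)) \<longlongrightarrow> 0) (at_right 0)"
    by (rule filterlim_compose[OF poly_times_exp_minus_tendsto_0 filterlim_inverse_at_top_right])
  then have "((\<lambda>h. flat p h / h) \<longlongrightarrow> 0) (at_right 0)"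
    by (rule Lim_transform_eventually)
       (auto simp: eventually_at_right_field flat_def field_simps intro!: exI[of _ 1])
  moreover have "((\<lambda>h. flat p h / h) \<longlongrightarrow> 0) (at_left 0)"
    by (rule tendsto_eventually)
       (auto simp: eventually_at_left_field flat_def intro!: exI[of _ "-1"])
  ultimately have "((\<lambda>h. flat p h / h) \<longlongrightarrow> 0) (at 0)"
    by (simp add: filterlim_split_at)
  then show ?thesis
    using equal by (simp add: has_field_derivative_iff flat_def)
qed

text \<open>Bumps need only products of affine substitutions; sums and scalar multiples are included
  because the product rule and the inner derivative of a substitution produce them.\<close>

inductive_set flats :: "(real \<Rightarrow> real) set" where
  "(\<lambda>x. flat p (u * x + v)) \<in> flats"
| "f \<in> flats \<Longrightarrow> g \<in> flats \<Longrightarrow> (\<lambda>x. f x + g x) \<in> flats"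
| "f \<in> flats \<Longrightarrow> g \<in> flats \<Longrightarrow> (\<lambda>x. f x * g x) \<in> flats"
| "f \<in> flats \<Longrightarrow> (\<lambda>x. c * f x) \<in> flats"

lemma flats_smooth: "f \<in> flats \<Longrightarrow> smooth f"
proof (erule smooth_coinduct)
  fix f assume "f \<in> flats"
  then show "\<exists>f'\<in>flats. \<forall>x. (f has_real_derivative f' x) (at x)"
  proof induction
    case (1 p u v)
    have "((\<lambda>x. flat p (u * x + v)) has_real_derivative
        u * flat ([:0, 0, 1:] * (p - pderiv p)) (u * x + v)) (at x)" for x
      by (rule DERIV_chain2[OF flat_has_derivative, THEN DERIV_cong])
         (auto intro!: derivative_eq_intros)
    then show ?case
      by (intro bexI[of _ "\<lambda>x. u * flat ([:0, 0, 1:] * (p - pderiv p)) (u * x + v)"] flats.intros)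
         auto
  next
    case (2 f g)
    then obtain f' g' where "f' \<in> flats" "\<forall>x. (f has_real_derivative f' x) (at x)"
      "g' \<in> flats" "\<forall>x. (g has_real_derivative g' x) (at x)" by blast
    then show ?case
      by (intro bexI[of _ "\<lambda>x. f' x + g' x"] flats.intros)
         (auto intro!: derivative_eq_intros)
  next
    case (3 f g)
    then obtain f' g' where "f' \<in> flats" "\<forall>x. (f has_real_derivative f' x) (at x)"
      "g' \<in> flats" "\<forall>x. (g has_real_derivative g' x) (at x)" by blast
    with 3 show ?case
      by (intro bexI[of _ "\<lambda>x. f' x * g x + f x * g' x"] flats.intros)
         (auto intro!: derivative_eq_intros)
  next
    case (4 f c)
    then obtain f' where "f' \<in> flats" "\<forall>x. (f has_real_derivative f' x) (at x)" by blast
    then show ?case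
      by (intro bexI[of _ "\<lambda>x. c * f' x"] flats.intros)
         (auto intro!: derivative_eq_intros)
  qed
qed

lemma test_functionsI:
  assumes "smooth f" "a < c" "d < b" "\<And>x. x \<notin> {c..d} \<Longrightarrow> f x = 0"
  shows "f \<in> test_functions a b"
proof -
  have "closure {x. f x \<noteq> 0} \<subseteq> {c..d}"
    by (rule closure_minimal) (use assms(4) in blast, simp)
  then show ?thesis using assms by (force simp: test_functions_def smooth_def)
qed

text \<open>
  Scaling by \<open>k\<close> inside the exponentials makes the bumps converge pointwise to the indicator of the
  open interval while staying bounded by 1.
\<close>

definition bump :: "real \<Rightarrow> real \<Rightarrow> real \<Rightarrow> real \<Rightarrow> real" where
  "bump k c d x = flat 1 (k * (x - c)) * flat 1 (k * (d - x))"

lemma bump_in_flats: "bump k c d \<in> flats"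
proof -
  have "(\<lambda>x. flat 1 (k * x + - k * c) * flat 1 (- k * x + k * d)) \<in> flats"
    by (intro flats.intros)
  then show ?thesis by (simp add: bump_def[abs_def] algebra_simps)
qed

lemma bump_outside: "k > 0 \<Longrightarrow> x \<notin> {c<..<d} \<Longrightarrow> bump k c d x = 0"
  by (auto simp: bump_def flat_def zero_less_mult_iff)

lemma bump_pos: "k > 0 \<Longrightarrow> x \<in> {c<..<d} \<Longrightarrow> bump k c d x > 0"
  by (auto simp: bump_def flat_def)

lemma bump_bounds: "k > 0 \<Longrightarrow> 0 \<le> bump k c d x \<and> bump k c d x \<le> 1"
  by (auto simp: bump_def flat_def intro!: mult_le_one)

lemma bump_test_function:
  assumes "k > 0" "a < c" "d < b" shows "bump k c d \<in> test_functions a b"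
  by (rule test_functionsI[OF flats_smooth[OF bump_in_flats], of a c d])
     (use assms bump_outside in \<open>auto\<close>)

lemma bump_tendsto_indicator:
  "(\<lambda>k. bump (real (Suc k)) c d x) \<longlonglongrightarrow> indicator {c<..<d} x"
proof (cases "x \<in> {c<..<d}")
  case True
  have "(\<lambda>k. flat 1 (real (Suc k) * y)) \<longlonglongrightarrow> 1" if "y > 0" for y
  proof -
    have "(\<lambda>k. exp (- (1 / y * inverse (real (Suc k))))) \<longlonglongrightarrow> exp (- (1 / y * 0))"
      by (intro tendsto_intros LIMSEQ_inverse_real_of_nat)
    then show ?thesis using that
      by (simp add: flat_def field_simps zero_less_mult_iff add_pos_nonneg)
  qed
  from tendsto_mult[OF this[of "x - c"] this[of "d - x"]] show ?thesis
    using True by (simp add: bump_def)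
next
  case False
  then show ?thesis using bump_outside[of "real (Suc _)" x c d] by simp
qed

lemma test_functions_outside:
  "\<phi> \<in> test_functions a b \<Longrightarrow> x \<notin> {a<..<b} \<Longrightarrow> \<phi> x = 0"
  using closure_subset[of "{x. \<phi> x \<noteq> 0}"] by (auto simp: test_functions_def)

section \<open>Integrable functions annihilating all test functions\<close>

lemma AE_lebesgue_on_neq:
  fixes a b c :: real
  shows "AE x in lebesgue_on {a..b}. x \<noteq> c"
proof -
  have "AE x in lebesgue. x \<noteq> c"
    by (rule AE_I'[of "{c}"]) auto
  then show ?thesis by (simp add: AE_restrict_space_iff) (erule eventually_mono, simp)
qed

lemma borel_measurable_imp_lebesgue_on:
  fixes f :: "real \<Rightarrow> real"
  assumes "f \<in> borel_measurable borel" shows "f \<in> borel_measurable (lebesgue_on S)"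
  using assms by (intro measurable_restrict_space1 measurable_completion) simp

lemma integrable_mult_bounded:
  fixes g h :: "'a \<Rightarrow> real"
  assumes "integrable M g" "h \<in> borel_measurable M" "\<And>x. x \<in> space M \<Longrightarrow> \<bar>h x\<bar> \<le> B"
  shows "integrable M (\<lambda>x. g x * h x)"
proof (rule Bochner_Integration.integrable_bound[of M "\<lambda>x. B * g x"])
  show "AE x in M. norm (g x * h x) \<le> norm (B * g x)"
  proof (rule AE_I2)
    fix x assume "x \<in> space M"
    then have "\<bar>h x\<bar> \<le> \<bar>B\<bar>" using assms(3)[of x] by linarith
    then have "\<bar>h x\<bar> * \<bar>g x\<bar> \<le> \<bar>B\<bar> * \<bar>g x\<bar>" by (rule mult_right_mono) simp
    then show "norm (g x * h x) \<le> norm (B * g x)" by (simp add: abs_mult mult.commute)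
  qed
qed (use assms in auto)

text \<open>The indicator of an open interval whose ends stay inside is a pointwise limit of bumps
  bounded by 1, so dominated convergence with majorant |g| carries the vanishing to the
  limit.\<close>

lemma integral_test_zero_imp_interval_zero:
  assumes g: "integrable (lebesgue_on {a..b}) g"
    and z: "\<And>\<phi>. \<phi> \<in> test_functions a b \<Longrightarrow> (LINT x|lebesgue_on {a..b}. g x * \<phi> x) = 0"
    and "a < c" "d < b"
  shows "(LINT x|lebesgue_on {a..b}. g x * indicator {c<..<d} x) = 0"
proof -
  have [measurable]: "g \<in> borel_measurable (lebesgue_on {a..b})" using g by simp
  have [measurable]: "indicat_real {c<..<d} \<in> borel_measurable (lebesgue_on {a..b})"
    by (rule borel_measurable_imp_lebesgue_on) simp
  have meas: "bump k c d \<in> borel_measurable (lebesgue_on {a..b})" for k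
  proof -
    have "continuous_on UNIV (bump k c d)"
      by (rule differentiable_imp_continuous_on)
         (use flats_smooth[OF bump_in_flats, of k c d, unfolded smooth_def] in \<open>metis funpow_0\<close>)
    then show ?thesis
      by (intro continuous_imp_measurable_on_sets_lebesgue) (auto intro: continuous_on_subset)
  qed
  have "(\<lambda>k. LINT x|lebesgue_on {a..b}. g x * bump (real (Suc k)) c d x)
          \<longlonglongrightarrow> (LINT x|lebesgue_on {a..b}. g x * indicator {c<..<d} x)"
  proof (rule integral_dominated_convergence[where w="\<lambda>x. \<bar>g x\<bar>"])
    show "AE x in lebesgue_on {a..b}. (\<lambda>k. g x * bump (real (Suc k)) c d x)
        \<longlonglongrightarrow> g x * indicator {c<..<d} x"
      by (intro AE_I2 tendsto_intros bump_tendsto_indicator)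
    show "AE x in lebesgue_on {a..b}. norm (g x * bump (real (Suc k)) c d x) \<le> \<bar>g x\<bar>" for k
      using bump_bounds[of "real (Suc k)" c d] by (auto simp: abs_mult intro!: mult_left_le)
  qed (use g meas in auto)
  moreover have "(LINT x|lebesgue_on {a..b}. g x * bump (real (Suc k)) c d x) = 0" for k
    by (intro z bump_test_function) (use assms in auto)
  ultimately show ?thesis by (simp add: LIMSEQ_const_iff)
qed

lemma integral_test_zero_imp_any_interval_zero:
  assumes "a < b" and g: "integrable (lebesgue_on {a..b}) g"
    and z: "\<And>\<phi>. \<phi> \<in> test_functions a b \<Longrightarrow> (LINT x|lebesgue_on {a..b}. g x * \<phi> x) = 0"
  shows "(LINT x|lebesgue_on {a..b}. g x * indicator {c<..<d} x) = 0"
proof -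
  have [measurable]: "g \<in> borel_measurable (lebesgue_on {a..b})" using g by simp
  have [measurable]: "indicat_real {c<..<d} \<in> borel_measurable (lebesgue_on {a..b})" for c d
    by (rule borel_measurable_imp_lebesgue_on) simp
  \<comment> \<open>Clipping to {a..b} and moving both ends inwards by 1/(k+1) gives ends strictly
    inside, as the previous lemma demands.\<close>
  let ?c = "\<lambda>k. max c a + inverse (real (Suc k))"
  let ?d = "\<lambda>k. min d b - inverse (real (Suc k))"
  have "(\<lambda>k. LINT x|lebesgue_on {a..b}. g x * indicator {?c k<..<?d k} x)
          \<longlonglongrightarrow> (LINT x|lebesgue_on {a..b}. g x * indicator {c<..<d} x)"
  proof (rule integral_dominated_convergence[where w="\<lambda>x. \<bar>g x\<bar>"])
    \<comment> \<open>At a and b the shrunken indicators are always 0 while the limiting one may be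
      1; these two points form a null set.\<close>
    have lim: "(\<lambda>k. indicator {?c k<..<?d k} x :: real) \<longlonglongrightarrow> indicator {c<..<d} x"
      if x: "x \<in> {a..b}" "x \<noteq> a" "x \<noteq> b" for x
    proof (cases "x \<in> {c<..<d}")
      case True
      have "(\<lambda>k. ?c k) \<longlonglongrightarrow> max c a + 0" "(\<lambda>k. ?d k) \<longlonglongrightarrow> min d b - 0"
        by (intro tendsto_intros LIMSEQ_inverse_real_of_nat)+
      then have "\<forall>\<^sub>F k in sequentially. ?c k < x" "\<forall>\<^sub>F k in sequentially. x < ?d k"
        using order_tendstoD(2)[of ?c "max c a" _ x] order_tendstoD(1)[of ?d "min d b" _ x] True x 
        by auto
      then have "\<forall>\<^sub>F k in sequentially. indicator {?c k<..<?d k} x = (indicator {c<..<d} x :: real)"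
        by eventually_elim (use True in \<open>simp add: indicator_def\<close>)
      then show ?thesis by (rule tendsto_eventually)
    next
      case False
      have "inverse (real (Suc k)) > 0" for k by simp
      then have "x \<notin> {?c k<..<?d k}" for k
        using False unfolding greaterThanLessThan_iff by (smt (verit))
      then have "(\<lambda>k. indicator {?c k<..<?d k} x :: real) = (\<lambda>_. 0)"
        by (auto simp: indicator_def simp del: greaterThanLessThan_iff)
      then show ?thesis using False by simp
    qed
    show "AE x in lebesgue_on {a..b}. (\<lambda>k. g x * indicator {?c k<..<?d k} x)
        \<longlonglongrightarrow> g x * indicator {c<..<d} x"
      using AE_lebesgue_on_neq[of a a b] AE_lebesgue_on_neq[of b a b] AE_space
    proof eventually_elim
      case (elim x)
      then show ?case by (intro tendsto_intros lim) auto
    qed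
    show "AE x in lebesgue_on {a..b}. norm (g x * indicator {?c k<..<?d k} x) \<le> \<bar>g x\<bar>" for k
      by (auto simp: abs_mult indicator_def)
  qed (use g in auto)
  moreover have "(LINT x|lebesgue_on {a..b}. g x * indicator {?c k<..<?d k} x) = 0" for k
  proof (rule integral_test_zero_imp_interval_zero[OF g z])
    have "inverse (real (Suc k)) > 0" by simp
    then show "a < ?c k" "?d k < b" by linarith+
  qed
  ultimately show ?thesis by (simp add: LIMSEQ_const_iff)
qed

text \<open>Vanishing propagates along the generation of the Borel sets: to complements by
  subtraction from the total integral, to disjoint unions by countable additivity.\<close>

lemma integral_zero_on_intervals_imp_borel:
  fixes g :: "real \<Rightarrow> real"
  assumes g: "integrable (lebesgue_on {a..b}) g"
    and z: "\<And>c d. (LINT x|lebesgue_on {a..b}. g x * indicator {c<..<d} x) = 0"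
    and A: "A \<in> sets borel"
  shows "(LINT x:A|lebesgue_on {a..b}. g x) = 0"
proof -
  let ?M = "lebesgue_on {a..b}"
  have bM: "B \<inter> space ?M \<in> sets ?M" if "B \<in> sets borel" for B :: "real set"
    using that by (auto simp: sets_restrict_space Int_commute)
  have ind: "indicator (B \<inter> space ?M) x *\<^sub>R g x = indicator B x *\<^sub>R g x"
    if "x \<in> space ?M" for B :: "real set" and x
    using that by (auto simp: indicator_def)
  have LI: "(LINT x:B|?M. g x) = (LINT x:(B \<inter> space ?M)|?M. g x)" for B :: "real set"
    unfolding set_lebesgue_integral_def
    by (rule Bochner_Integration.integral_cong[OF refl]) (rule ind[symmetric])
  have si: "set_integrable ?M (B \<inter> space ?M) g" if "B \<in> sets borel" for B :: "real set"
    unfolding set_integrable_def by (rule integrable_mult_indicator[OF bM[OF that] g])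
  \<comment> \<open>The open interval from a - 1 to b + 1 covers {a..b}, so the total integral is
    itself an interval integral.\<close>
  have total: "(LINT x|?M. g x) = 0"
  proof -
    have "(LINT x|?M. g x * indicator {a - 1<..<b + 1} x) = (LINT x|?M. g x)"
      by (rule Bochner_Integration.integral_cong) auto
    then show ?thesis using z[of "a - 1" "b + 1"] by simp
  qed
  show ?thesis using A
  proof (induction rule: borel_set_induct)
    case empty
    then show ?case by (simp add: set_lebesgue_integral_def)
  next
    \<comment> \<open>The induction starts from closed intervals while the assumption concerns open
      ones; they differ in two points.\<close>
    case (interval c d)
    have [measurable]: "indicat_real {c<..<d} \<in> borel_measurable ?M"
        "indicat_real {c..d} \<in> borel_measurable ?M"
      by (rule borel_measurable_imp_lebesgue_on; simp)+
    have [measurable]: "g \<in> borel_measurable ?M" using g by simp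
    have "AE x in ?M. g x * indicator {c<..<d} x = indicator {c..d} x *\<^sub>R g x"
      using AE_lebesgue_on_neq[of c a b] AE_lebesgue_on_neq[of d a b]
      by eventually_elim (auto simp: indicator_def)
    then have "(LINT x:{c..d}|?M. g x) = (LINT x|?M. g x * indicator {c<..<d} x)"
      unfolding set_lebesgue_integral_def
      by (intro integral_cong_AE) auto
    then show ?case using z by simp
  next
    case (compl B)
    have "(LINT x:(- B)|?M. g x) = (LINT x|?M. g x - indicator (B \<inter> space ?M) x *\<^sub>R g x)"
      unfolding set_lebesgue_integral_def
      by (rule Bochner_Integration.integral_cong) (auto simp: indicator_def)
    also have "\<dots> = (LINT x|?M. g x) - (LINT x|?M. indicator (B \<inter> space ?M) x *\<^sub>R g x)"
      using si[OF compl(1)] unfolding set_integrable_def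
      by (rule Bochner_Integration.integral_diff[OF g])
    also have "\<dots> = 0 - (LINT x:B|?M. g x)"
      unfolding total LI[of B] by (simp add: set_lebesgue_integral_def)
    finally show ?case using compl by simp
  next
    case (union B)
    have "(LINT x:(\<Union>i. B i)|?M. g x) = (LINT x:(\<Union>i. B i \<inter> space ?M)|?M. g x)"
      unfolding LI[of "\<Union>i. B i"] by (simp add: Int_UN_distrib2)
    also have "\<dots> = (\<Sum>i. LINT x:(B i \<inter> space ?M)|?M. g x)"
    proof (rule lebesgue_integral_countable_add)
      show "set_integrable ?M (\<Union>i. B i \<inter> space ?M) g"
        using si[of "\<Union>i. B i"] union(2) by (simp add: Int_UN_distrib2)
    qed (use bM union(1,2) in \<open>auto simp: disjoint_family_on_def\<close>)
    also have "\<dots> = 0" using union(3) LI by simp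
    finally show ?case .
  qed
qed

lemma integral_test_zero_imp_AE_zero:
  assumes "a < b" and g: "integrable (lebesgue_on {a..b}) g"
    and z: "\<And>\<phi>. \<phi> \<in> test_functions a b \<Longrightarrow> (LINT x|lebesgue_on {a..b}. g x * \<phi> x) = 0"
  shows "AE x in lebesgue_on {a..b}. g x = 0"
proof -
  let ?M = "lebesgue_on {a..b}"
  have [measurable]: "g \<in> borel_measurable ?M" using g by simp
  have "(\<lambda>x. indicator {a..b} x *\<^sub>R g x) \<in> borel_measurable (completion lborel)"
    using borel_measurable_integrable[OF g] by (subst (asm) borel_measurable_restrict_space_iff) auto
  \<comment> \<open>Passing to a Borel function that equals g almost everywhere on {a..b} makes the
    sets where it is positive or negative Borel.\<close>
  from completion_ex_borel_measurable_real[OF this] obtain h where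
    h: "h \<in> borel_measurable lborel" "AE x in lborel. indicator {a..b} x *\<^sub>R g x = h x" by blast
  have "AE x in lebesgue. indicator {a..b} x *\<^sub>R g x = h x" using h(2) by (rule AE_completion)
  then have gh: "AE x in ?M. g x = h x"
    by (simp add: AE_restrict_space_iff) (erule eventually_mono, auto)
  have set_zero: "(LINT x:A|?M. g x) = 0" if "A \<in> sets borel" for A
    by (rule integral_zero_on_intervals_imp_borel[OF g
          integral_test_zero_imp_any_interval_zero[OF assms] that])
  \<comment> \<open>Used for s = 1 and s = -1. On the Borel set where s h is positive the integrand
    s g is nonnegative almost everywhere and has integral 0, so s g has no positive part.\<close>
  have zero: "AE x in ?M. s * g x \<le> 0" for s
  proof -
    let ?A = "{x. 0 < s * h x}"
    have A: "?A \<in> sets borel" using h(1) by simp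
    have AM[measurable]: "indicat_real ?A \<in> borel_measurable ?M"
      by (rule borel_measurable_imp_lebesgue_on) (use A in simp)
    have "integrable ?M (\<lambda>x. g x * indicat_real ?A x)"
      by (rule integrable_mult_bounded[OF g AM, of 1]) (auto simp: indicator_def)
    then have int: "integrable ?M (\<lambda>x. s * (indicator ?A x * g x))"
      by (simp add: mult.commute)
    have nn: "AE x in ?M. 0 \<le> s * (indicator ?A x * g x)"
      using gh by eventually_elim (auto simp: indicator_def)
    have "(LINT x|?M. s * (indicator ?A x * g x)) = 0"
      using set_zero[OF A] by (simp add: set_lebesgue_integral_def)
    then have "AE x in ?M. s * (indicator ?A x * g x) = 0"
      using integral_nonneg_eq_0_iff_AE[OF int nn] by simp
    with gh show ?thesis by eventually_elim (auto simp: indicator_def split: if_splits)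
  qed
  from zero[of 1] zero[of "-1"] show ?thesis by eventually_elim auto
qed

section \<open>Fubini on a triangle\<close>

lemma continuous_on_imp_borel_measurable_lebesgue_on:
  fixes f :: "real \<Rightarrow> real"
  assumes "continuous_on {a..b} f" shows "f \<in> borel_measurable (lebesgue_on {a..b})"
  using assms by (intro continuous_imp_measurable_on_sets_lebesgue) auto

lemma lebesgue_on_indicator_integral:
  fixes f :: "real \<Rightarrow> real"
  assumes "S \<subseteq> {a..b}" "S \<in> sets borel"
  shows "(LINT x|lebesgue_on S. f x) = (LINT x|lebesgue_on {a..b}. indicator S x * f x)"
    and "integrable (lebesgue_on S) f \<longleftrightarrow> integrable (lebesgue_on {a..b}) (\<lambda>x. indicator S x * f x)"
proof -
  have e: "indicat_real {a..b} x * (indicator S x * f x) = indicator S x * f x" for x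
    using assms(1) by (auto simp: indicator_def)
  show "(LINT x|lebesgue_on S. f x) = (LINT x|lebesgue_on {a..b}. indicator S x * f x)"
    using assms(2) by (subst (1 2) integral_restrict_space) (simp_all add: e)
  show "integrable (lebesgue_on S) f \<longleftrightarrow> integrable (lebesgue_on {a..b}) (\<lambda>x. indicator S x * f x)"
    using assms(2) by (subst (1 2) integrable_restrict_space) (simp_all add: e)
qed

lemma integrable_lebesgue_on_subinterval:
  fixes f :: "real \<Rightarrow> real"
  assumes "integrable (lebesgue_on {a..b}) f" "a \<le> c" "d \<le> b"
  shows "integrable (lebesgue_on {c..d}) f"
proof (cases "c \<le> d")
  case True
  then show ?thesis
    using integrable_subinterval[OF assms(1), of c d] assms by auto
next
  case False
  then show ?thesis by (simp add: integrable_restrict_space)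
qed

lemma indefinite_integral_continuous_on:
  fixes f :: "real \<Rightarrow> real"
  assumes "integrable (lebesgue_on {a..b}) f"
  shows "continuous_on {a..b} (\<lambda>x. LINT t|lebesgue_on {a..x}. f t)"
proof -
  have "f integrable_on {a..b}"
    using integrable_on_lebesgue_on[OF assms] by simp
  then have "continuous_on {a..b} (\<lambda>x. integral {a..x} f)"
    by (rule indefinite_integral_continuous_1)
  then show ?thesis
  proof (rule continuous_on_eq)
    show "integral {a..x} f = (LINT t|lebesgue_on {a..x}. f t)" if "x \<in> {a..b}" for x
    using lebesgue_integral_eq_integral[OF integrable_lebesgue_on_subinterval[OF assms, of a x]] that
      by simp
  qed
qed

text \<open>Extending the kernel by zero to t > x turns the triangle into the square, where ordinary
  Fubini applies: f(x) g(t) is integrable for the product measure and K is bounded. The factor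
  \<open>indicator {t..} x\<close> encodes t \<le> x.\<close>

lemma Fubini_triangle:
  fixes f g :: "real \<Rightarrow> real" and K :: "real \<Rightarrow> real \<Rightarrow> real"
  assumes f: "integrable (lebesgue_on {a..b}) f" and g: "integrable (lebesgue_on {a..b}) g"
    and K: "(\<lambda>(x, t). K x t) \<in> borel_measurable borel"
    and B: "\<And>x t. x \<in> {a..b} \<Longrightarrow> t \<in> {a..b} \<Longrightarrow> \<bar>K x t\<bar> \<le> B"
  shows "(LINT x|lebesgue_on {a..b}. f x * (LINT t|lebesgue_on {a..x}. K x t * g t))
       = (LINT t|lebesgue_on {a..b}. (LINT x|lebesgue_on {t..b}. K x t * f x) * g t)" (is "?l = ?r")
    and "integrable (lebesgue_on {a..b}) (\<lambda>x. f x * (LINT t|lebesgue_on {a..x}. K x t * g t))"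
    and "integrable (lebesgue_on {a..b}) (\<lambda>t. (LINT x|lebesgue_on {t..b}. K x t * f x) * g t)"
proof -
  let ?M = "lebesgue_on {a..b}"
  have "finite_measure ?M" by (rule finite_measure_lebesgue_on) simp
  then interpret M: finite_measure ?M .
  interpret P: pair_sigma_finite ?M ?M ..
  let ?h = "\<lambda>(x, t). f x * (g t * (indicator {t..} x * K x t))"
  have [measurable]: "f \<in> borel_measurable ?M" "g \<in> borel_measurable ?M" using f g by auto
  have id: "(\<lambda>x. x) \<in> borel_measurable ?M" by (rule borel_measurable_imp_lebesgue_on) simp
  have KI: "(\<lambda>(x, t). indicator {t..} x * K x t) \<in> borel_measurable borel"
  proof -
    have "{(x, t). t \<le> x} \<in> sets (borel :: (real \<times> real) measure)"
      unfolding case_prod_beta by (intro borel_closed closed_Collect_le continuous_intros)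
    then have "(\<lambda>p. indicator {(x, t). t \<le> x} p * (\<lambda>(x, t). K x t) p) \<in> borel_measurable borel"
      using K by measurable
    then show ?thesis by (auto simp: case_prod_beta indicator_def cong: if_cong)
  qed
  have KM: "(\<lambda>(x, t). indicator {t..} x * K x t) \<in> borel_measurable (?M \<Otimes>\<^sub>M ?M)"
  proof -
    \<comment> \<open>Borel measurability of the kernel in the plane is pulled back along the
      identity map from the product of the two Lebesgue spaces.\<close>
    have "(\<lambda>p. (fst p, snd p)) \<in> measurable (?M \<Otimes>\<^sub>M ?M) (borel \<Otimes>\<^sub>M borel)"
      using id by measurable
    then have "(\<lambda>p. p) \<in> measurable (?M \<Otimes>\<^sub>M ?M) (borel :: (real \<times> real) measure)"
      by (simp add: borel_prod)
    from measurable_compose[OF this KI] show ?thesis .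
  qed
  have hM: "?h \<in> borel_measurable (?M \<Otimes>\<^sub>M ?M)"
    using KM by (simp add: case_prod_beta) measurable
  have fg: "integrable (?M \<Otimes>\<^sub>M ?M) (\<lambda>(x, t). f x * g t)"
    by (rule P.Fubini_integrable) (use f g in \<open>auto simp: abs_mult\<close>)
  have "\<bar>indicator {t..} x * K x t\<bar> \<le> B" if "x \<in> {a..b}" "t \<in> {a..b}" for x t
    using B[OF that] by (auto simp: indicator_def)
  then have "integrable (?M \<Otimes>\<^sub>M ?M)
      (\<lambda>p. (case p of (x, t) \<Rightarrow> f x * g t) * (case p of (x, t) \<Rightarrow> indicator {t..} x * K x t))"
    by (intro integrable_mult_bounded[OF fg KM, of B]) (auto simp: space_pair_measure)
  also have "(\<lambda>p. (case p of (x, t) \<Rightarrow> f x * g t) * (case p of (x, t) \<Rightarrow> indicator {t..} x * K x t)) = ?h"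
    by (auto simp: fun_eq_iff mult.assoc)
  finally have h: "integrable (?M \<Otimes>\<^sub>M ?M) ?h" .
  have inner1: "(LINT t|?M. ?h (x, t)) = f x * (LINT t|lebesgue_on {a..x}. K x t * g t)"
    if "x \<in> {a..b}" for x
  proof -
    have "(LINT t|lebesgue_on {a..x}. K x t * g t) = (LINT t|?M. indicator {a..x} t * (K x t * g t))"
      by (rule lebesgue_on_indicator_integral(1)) (use that in auto)
    also have "\<dots> = (LINT t|?M. g t * (indicator {t..} x * K x t))"
      by (rule Bochner_Integration.integral_cong) (auto simp: indicator_def)
    finally show ?thesis by simp
  qed
  have inner2: "(LINT x|?M. ?h (x, t)) = (LINT x|lebesgue_on {t..b}. K x t * f x) * g t"
    if "t \<in> {a..b}" for t
  proof -
    have "(LINT x|lebesgue_on {t..b}. K x t * f x) = (LINT x|?M. indicator {t..b} x * (K x t * f x))"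
      by (rule lebesgue_on_indicator_integral(1)) (use that in auto)
    also have "\<dots> = (LINT x|?M. f x * (indicator {t..} x * K x t))"
      by (rule Bochner_Integration.integral_cong) (auto simp: indicator_def)
    finally have "(LINT x|lebesgue_on {t..b}. K x t * f x) * g t
        = (LINT x|?M. f x * (indicator {t..} x * K x t) * g t)" by simp
    then show ?thesis by (simp add: ac_simps)
  qed
  have "?l = (LINT x|?M. (LINT t|?M. ?h (x, t)))"
    by (rule Bochner_Integration.integral_cong[OF refl]) (rule inner1[symmetric], simp)
  also have "\<dots> = (LINT t|?M. (LINT x|?M. ?h (x, t)))"
    using P.Fubini_integral[of "\<lambda>x t. ?h (x, t)"] h by (simp add: case_prod_beta)
  also have "\<dots> = ?r"
    by (rule Bochner_Integration.integral_cong) (use inner2 in auto)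
  finally show "?l = ?r" .
  have "integrable ?M (\<lambda>x. LINT t|?M. ?h (x, t))"
    using P.integrable_fst'[OF h] by simp
  then show "integrable ?M (\<lambda>x. f x * (LINT t|lebesgue_on {a..x}. K x t * g t))"
    by (rule Bochner_Integration.integrable_cong[THEN iffD1, rotated -1]) (use inner1 in auto)
  have "integrable ?M (\<lambda>t. LINT x|?M. ?h (x, t))"
    using P.integrable_snd[of "\<lambda>x t. ?h (x, t)"] h by (simp add: case_prod_beta)
  then show "integrable ?M (\<lambda>t. (LINT x|lebesgue_on {t..b}. K x t * f x) * g t)"
    by (rule Bochner_Integration.integrable_cong[THEN iffD1, rotated -1]) (use inner2 in auto)
qed

section \<open>Functions with weak derivatives are primitives\<close>

lemma smooth_has_derivative: "smooth f \<Longrightarrow> (f has_real_derivative deriv f x) (at x)"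
proof -
  assume "smooth f"
  then have "(deriv ^^ 0) f differentiable_on UNIV" unfolding smooth_def by blast
  then show ?thesis
    by (simp add: DERIV_deriv_iff_real_differentiable differentiable_on_def)
qed

lemma smooth_deriv: "smooth f \<Longrightarrow> smooth (deriv f)"
  unfolding smooth_def
proof
  fix k assume "\<forall>k. (deriv ^^ k) f differentiable_on UNIV"
  then have "(deriv ^^ Suc k) f differentiable_on UNIV" by blast
  then show "(deriv ^^ k) (deriv f) differentiable_on UNIV" by (simp only: funpow_Suc_right o_apply)
qed

lemma smooth_continuous_on: "smooth f \<Longrightarrow> continuous_on S f"
  by (rule DERIV_continuous_on[OF has_field_derivative_at_within[OF smooth_has_derivative]])

lemma smooth_linear_combination:
  assumes "smooth f" "smooth g" shows "smooth (\<lambda>x. f x - k * g x)"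
proof (rule smooth_coinduct[where S = "{\<lambda>x. f x - k * g x |f g. smooth f \<and> smooth g}"])
  fix h assume "h \<in> {\<lambda>x. f x - k * g x |f g. smooth f \<and> smooth g}"
  then obtain f g where h: "h = (\<lambda>x. f x - k * g x)" "smooth f" "smooth g" by blast
  show "\<exists>h'\<in>{\<lambda>x. f x - k * g x |f g. smooth f \<and> smooth g}. \<forall>x. (h has_real_derivative h' x) (at x)"
  proof (intro bexI[of _ "\<lambda>x. deriv f x - k * deriv g x"] allI)
    show "(h has_real_derivative deriv f x - k * deriv g x) (at x)" for x
      unfolding h(1) using h(2,3)[THEN smooth_has_derivative]
      by (auto intro!: derivative_eq_intros)
  qed (use h smooth_deriv in blast)
qed (use assms in blast)

lemma test_functions_smooth: "\<phi> \<in> test_functions a b \<Longrightarrow> smooth \<phi>"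
  by (simp add: test_functions_def smooth_def)

lemma test_functions_support:
  assumes "\<phi> \<in> test_functions a b" "a < b"
  shows "\<exists>c d. a < c \<and> c < d \<and> d < b \<and> (\<forall>x. x \<notin> {c..d} \<longrightarrow> \<phi> x = 0)"
proof -
  let ?K = "closure {x. \<phi> x \<noteq> 0}"
  have K: "?K \<subseteq> {a<..<b}" using assms(1) by (simp add: test_functions_def)
  have "?K \<subseteq> {a..b}" using K by (rule order_trans) auto
  then have "compact ?K"
    using bounded_subset[OF compact_imp_bounded[OF compact_Icc[of a b]]]
    by (auto simp: compact_eq_bounded_closed)
  \<comment> \<open>Adding the two points that cut (a, b) into thirds makes the compact set nonempty
    and forces c < d, even if the test function vanishes identically.\<close>
  then have "compact (insert ((2 * a + b) / 3) (insert ((a + 2 * b) / 3) ?K))" (is "compact ?L")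
    by simp
  moreover have ne: "?L \<noteq> {}" by simp
  ultimately obtain c d where cd: "c \<in> ?L" "\<And>x. x \<in> ?L \<Longrightarrow> c \<le> x" "d \<in> ?L" "\<And>x. x \<in> ?L \<Longrightarrow> x \<le> d"
    using compact_attains_inf[OF _ ne] compact_attains_sup[OF _ ne] by blast
  have L: "?L \<subseteq> {a<..<b}" using K assms(2) by auto
  have "c \<le> (2 * a + b) / 3" by (rule cd(2)) blast
  moreover have "(a + 2 * b) / 3 \<le> d" by (rule cd(4)) blast
  moreover have "(2 * a + b) / 3 < (a + 2 * b) / 3" using assms(2) by simp
  ultimately have "c < d" by (meson le_less_trans less_le_trans)
  moreover have "\<phi> x = 0" if "x \<notin> {c..d}" for x
    using cd(2,4)[of x] that closure_subset[of "{x. \<phi> x \<noteq> 0}"] by auto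
  moreover have "a < c" "d < b" using cd(1,3) L by auto
  ultimately show ?thesis by blast
qed

lemma lebesgue_FTC:
  fixes f f' :: "real \<Rightarrow> real"
  assumes "c \<le> d" "\<And>x. (f has_real_derivative f' x) (at x)" "continuous_on UNIV f'"
  shows "(LINT x|lebesgue_on {c..d}. f' x) = f d - f c"
proof -
  have "integrable (lebesgue_on {c..d}) f'"
    by (rule continuous_imp_integrable_real) (rule continuous_on_subset[OF assms(3)], simp)
  then have "(LINT x|lebesgue_on {c..d}. f' x) = integral {c..d} f'"
    by (rule lebesgue_integral_eq_integral) simp
  also have "\<dots> = f d - f c"
    by (intro integral_unique fundamental_theorem_of_calculus)
       (use assms(1,2) in \<open>auto simp: has_real_derivative_iff_has_vector_derivative
          intro: has_vector_derivative_at_within\<close>)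
  finally show ?thesis .
qed

section \<open>Almost-everywhere equality, continuous representatives and uniqueness of weak
  derivatives\<close>

lemma continuous_AE_eq_imp_eq:
  fixes f g :: "real \<Rightarrow> real"
  assumes "a < b" "continuous_on {a..b} f" "continuous_on {a..b} g"
    and "AE x in lebesgue_on {a..b}. f x = g x" and "x \<in> {a..b}"
  shows "f x = g x"
proof -
  have c: "continuous_on {a..b} (\<lambda>x. \<bar>f x - g x\<bar>)" using assms by (intro continuous_intros)
  have "(LINT x|lebesgue_on {a..b}. \<bar>f x - g x\<bar>) = 0"
    by (rule integral_eq_zero_AE) (use assms(4) in eventually_elim, simp)
  then have "integral {a..b} (\<lambda>x. \<bar>f x - g x\<bar>) = 0"
    using lebesgue_integral_eq_integral[OF continuous_imp_integrable_real[OF c]] by simp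
  then show ?thesis using integral_eq_0_iff[OF c assms(1)] assms(5) by simp
qed

text \<open>Continuous representatives of the same class agree at every point, so the choice hidden
  in \<open>cont_rep\<close> is evaluated by exhibiting any one of them.\<close>

lemma cont_rep_eq:
  assumes "a < b" "continuous_on {a..b} g" "AE x in lebesgue_on {a..b}. f x = g x" "x \<in> {a..b}"
  shows "cont_rep a b f x = g x"
proof -
  let ?P = "\<lambda>g. continuous_on {a..b} g \<and> (AE x in lebesgue_on {a..b}. f x = g x)"
  have P: "?P (cont_rep a b f)"
    unfolding cont_rep_def by (rule someI[of ?P]) (use assms in auto)
  then have "AE x in lebesgue_on {a..b}. f x = cont_rep a b f x" by blast
  with assms(3) have "AE x in lebesgue_on {a..b}. cont_rep a b f x = g x"
    by eventually_elim simp
  then show ?thesis using continuous_AE_eq_imp_eq[OF assms(1) _ assms(2) _ assms(4)] P by blast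
qed

text \<open>Completeness of Lebesgue measure is what makes this hold: changing a function on a null
  set cannot destroy measurability.\<close>

lemma measurable_lebesgue_on_cong_AE:
  fixes f g :: "real \<Rightarrow> real"
  assumes "f \<in> borel_measurable (lebesgue_on {a..b})" "AE x in lebesgue_on {a..b}. f x = g x"
  shows "g \<in> borel_measurable (lebesgue_on {a..b})"
proof -
  have "(\<lambda>x. indicator {a..b} x *\<^sub>R f x) \<in> borel_measurable lebesgue"
    using assms(1) by (subst (asm) borel_measurable_restrict_space_iff) auto
  moreover have "AE x in lebesgue. x \<in> {a..b} \<longrightarrow> f x = g x"
    using assms(2) by (simp add: AE_restrict_space_iff)
  then have "AE x in lebesgue. indicator {a..b} x *\<^sub>R f x = indicator {a..b} x *\<^sub>R g x"
    by eventually_elim (auto simp: indicator_def)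
  ultimately have "(\<lambda>x. indicator {a..b} x *\<^sub>R g x) \<in> borel_measurable lebesgue"
    by (rule borel_measurable_AE)
  then show ?thesis by (subst borel_measurable_restrict_space_iff) auto
qed

lemma integrable_lebesgue_on_cong_AE:
  fixes f g :: "real \<Rightarrow> real"
  assumes "integrable (lebesgue_on {a..b}) f" "AE x in lebesgue_on {a..b}. f x = g x"
  shows "integrable (lebesgue_on {a..b}) g"
  by (rule integrable_cong_AE_imp[OF assms(1) measurable_lebesgue_on_cong_AE[OF _ assms(2)] assms(2)])
     (use assms(1) in simp)

lemma has_weak_deriv_cong_AE:
  assumes "has_weak_deriv a b f g" "AE x in lebesgue_on {a..b}. f x = f' x"
  shows "has_weak_deriv a b f' g"
proof -
  have f: "integrable (lebesgue_on {a..b}) f" and f': "integrable (lebesgue_on {a..b}) f'"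
    using assms integrable_lebesgue_on_cong_AE[OF _ assms(2)] by (auto simp: has_weak_deriv_def)
  have "(LINT x|lebesgue_on {a..b}. f' x * deriv \<phi> x) = (LINT x|lebesgue_on {a..b}. f x * deriv \<phi> x)"
    if "\<phi> \<in> test_functions a b" for \<phi>
  proof (rule integral_cong_AE)
    have [measurable]: "deriv \<phi> \<in> borel_measurable (lebesgue_on {a..b})"
      by (rule continuous_on_imp_borel_measurable_lebesgue_on[OF smooth_continuous_on[OF smooth_deriv[OF test_functions_smooth[OF that]]]])
    show "(\<lambda>x. f' x * deriv \<phi> x) \<in> borel_measurable (lebesgue_on {a..b})"
      "(\<lambda>x. f x * deriv \<phi> x) \<in> borel_measurable (lebesgue_on {a..b})"
      using f f' by measurable
    show "AE x in lebesgue_on {a..b}. f' x * deriv \<phi> x = f x * deriv \<phi> x"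
      using assms(2) by eventually_elim simp
  qed
  then show ?thesis using assms(1) f' by (simp add: has_weak_deriv_def)
qed

lemma integrable_mult_continuous:
  fixes g h :: "real \<Rightarrow> real"
  assumes "integrable (lebesgue_on {a..b}) g" "continuous_on {a..b} h"
  shows "integrable (lebesgue_on {a..b}) (\<lambda>x. g x * h x)"
proof -
  obtain B where "\<forall>x\<in>{a..b}. norm (h x) \<le> B"
    using compact_imp_bounded[OF compact_continuous_image[OF assms(2)]] by (auto simp: bounded_iff)
  then show ?thesis
    by (intro integrable_mult_bounded[OF assms(1) continuous_on_imp_borel_measurable_lebesgue_on[OF assms(2)], of B]) auto
qed

text \<open>The difference of two weak derivatives annihilates every test function.\<close>

lemma has_weak_deriv_unique:
  assumes "a < b" "has_weak_deriv a b f g" "has_weak_deriv a b f g'"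
  shows "AE x in lebesgue_on {a..b}. g x = g' x"
proof -
  have g: "integrable (lebesgue_on {a..b}) g" "integrable (lebesgue_on {a..b}) g'"
    using assms(2,3) by (auto simp: has_weak_deriv_def)
  have "AE x in lebesgue_on {a..b}. g x - g' x = 0"
  proof (rule integral_test_zero_imp_AE_zero[OF assms(1)])
    fix \<phi> assume \<phi>: "\<phi> \<in> test_functions a b"
    have c: "continuous_on {a..b} \<phi>" by (rule smooth_continuous_on[OF test_functions_smooth[OF \<phi>]])
    have "(LINT x|lebesgue_on {a..b}. g x * \<phi> x) = (LINT x|lebesgue_on {a..b}. g' x * \<phi> x)"
      using assms(2,3) \<phi> unfolding has_weak_deriv_def by fastforce
    then show "(LINT x|lebesgue_on {a..b}. (g x - g' x) * \<phi> x) = 0"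
      using g[THEN integrable_mult_continuous[OF _ c]] by (simp add: left_diff_distrib)
  qed (use g in auto)
  then show ?thesis by eventually_elim simp
qed

lemma weak_deriv_AE_eq:
  assumes "a < b" "has_weak_deriv a b f g"
  shows "has_weak_deriv a b f (weak_deriv a b f)"
    and "AE x in lebesgue_on {a..b}. weak_deriv a b f x = g x"
proof -
  show *: "has_weak_deriv a b f (weak_deriv a b f)"
    unfolding weak_deriv_def by (rule someI[of "has_weak_deriv a b f", OF assms(2)])
  show "AE x in lebesgue_on {a..b}. weak_deriv a b f x = g x"
    by (rule has_weak_deriv_unique[OF assms(1) * assms(2)])
qed

text \<open>A test function of mean zero is the derivative of a test function. Correcting an
  arbitrary \<psi> by a multiple of one fixed \<open>\<psi>0\<close> with nonzero integral gives
  mean zero, and h paired with the corrected function vanishes. This says that h - c annihilates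
  \<psi>, with c depending only on h and \<open>\<psi>0\<close>.\<close>

lemma du_Bois_Reymond:
  assumes "a < b" and h: "integrable (lebesgue_on {a..b}) h"
    and z: "\<And>\<phi>. \<phi> \<in> test_functions a b \<Longrightarrow> (LINT x|lebesgue_on {a..b}. h x * deriv \<phi> x) = 0"
  obtains c where "AE x in lebesgue_on {a..b}. h x = c"
proof -
  let ?M = "lebesgue_on {a..b}"
  \<comment> \<open>Any test function with nonzero integral would serve; the middle third is
    nonempty and strictly inside because a < b.\<close>
  define \<psi>0 where "\<psi>0 = bump 1 ((2 * a + b) / 3) ((a + 2 * b) / 3)"
  have \<psi>0: "\<psi>0 \<in> test_functions a b"
    unfolding \<psi>0_def by (rule bump_test_function) (use assms in auto)
  have sm0: "smooth \<psi>0" by (rule test_functions_smooth[OF \<psi>0])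
  have i0: "integrable ?M \<psi>0" by (rule continuous_imp_integrable_real[OF smooth_continuous_on[OF sm0]])
  define I where "I = (LINT x|?M. \<psi>0 x)"
  have "I \<noteq> 0"
  proof
    assume "I = 0"
    then have "integral {a..b} \<psi>0 = 0"
      using lebesgue_integral_eq_integral[OF i0] by (simp add: I_def)
    then have "\<forall>x\<in>{a..b}. \<psi>0 x = 0"
      using integral_eq_0_iff[OF smooth_continuous_on[OF sm0] assms(1)] bump_bounds[of 1]
      by (simp add: \<psi>0_def)
    moreover have "\<psi>0 ((a + b) / 2) > 0"
      unfolding \<psi>0_def by (rule bump_pos) (use assms(1) in \<open>auto simp: field_simps\<close>)
    moreover have "(a + b) / 2 \<in> {a..b}" using assms(1) by auto
    ultimately show False by auto
  qed
  \<comment> \<open>The only candidate: a constant h = c paired with \<open>\<psi>0\<close> would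
    give c times I.\<close>
  define c where "c = (LINT x|?M. h x * \<psi>0 x) / I"
  have "AE x in ?M. h x - c = 0"
  proof (rule integral_test_zero_imp_AE_zero[OF assms(1)])
    show "integrable ?M (\<lambda>x. h x - c)" using h by simp
    fix \<psi> assume \<psi>: "\<psi> \<in> test_functions a b"
    have sm: "smooth \<psi>" by (rule test_functions_smooth[OF \<psi>])
    have i: "integrable ?M \<psi>" by (rule continuous_imp_integrable_real[OF smooth_continuous_on[OF sm]])
    define k where "k = (LINT x|?M. \<psi> x) / I"
    define \<theta> where "\<theta> x = \<psi> x - k * \<psi>0 x" for x
    have sm\<theta>: "smooth \<theta>" unfolding \<theta>_def[abs_def] by (rule smooth_linear_combination[OF sm sm0])
    have "(LINT x|?M. \<theta> x) = 0"
      using i i0 \<open>I \<noteq> 0\<close> by (simp add: \<theta>_def I_def[symmetric] k_def)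
    obtain c1 d1 where cd1: "a < c1" "c1 < d1" "d1 < b" "\<And>x. x \<notin> {c1..d1} \<Longrightarrow> \<psi> x = 0"
      using test_functions_support[OF \<psi> assms(1)] by blast
    obtain c2 d2 where cd2: "a < c2" "c2 < d2" "d2 < b" "\<And>x. x \<notin> {c2..d2} \<Longrightarrow> \<psi>0 x = 0"
      using test_functions_support[OF \<psi>0 assms(1)] by blast
    define c' d' where "c' = min c1 c2" and "d' = max d1 d2"
    have \<theta>0: "\<theta> x = 0" if "x < c' \<or> d' < x" for x
    proof -
      have "x \<notin> {c1..d1}" "x \<notin> {c2..d2}" using that by (auto simp: c'_def d'_def)
      then show ?thesis using cd1(4) cd2(4) by (simp add: \<theta>_def)
    qed
    \<comment> \<open>An antiderivative on the whole line, since test functions live on all of the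
      reals.\<close>
    obtain P where P: "\<And>x. (P has_real_derivative \<theta> x) (at x)"
    proof -
      have "\<exists>F. \<forall>x. - \<infinity> < ereal x \<longrightarrow> ereal x < \<infinity> \<longrightarrow> (F has_vector_derivative \<theta> x) (at x)"
        by (rule einterval_antiderivative)
           (use smooth_has_derivative[OF sm\<theta>] in \<open>auto intro: DERIV_isCont\<close>)
      then show ?thesis using that by (auto simp: has_real_derivative_iff_has_vector_derivative)
    qed
    have FTC: "(LINT x|lebesgue_on {s..t}. \<theta> x) = P t - P s" if "s \<le> t" for s t
      by (rule lebesgue_FTC[OF that P smooth_continuous_on[OF sm\<theta>]])
    have Pab: "P b = P a" using FTC[of a b] assms(1) \<open>(LINT x|?M. \<theta> x) = 0\<close> by simp
    have const: "P t = P s" if "s \<le> t" "\<And>x. x \<in> {s<..<t} \<Longrightarrow> \<theta> x = 0" for s t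
    proof -
      have "AE x in lebesgue_on {s..t}. \<theta> x = 0"
        using AE_lebesgue_on_neq[of s s t] AE_lebesgue_on_neq[of t s t] AE_space
        by eventually_elim (use that(2) in auto)
      then have "(LINT x|lebesgue_on {s..t}. \<theta> x) = 0" by (rule integral_eq_zero_AE)
      then show ?thesis using FTC[OF that(1)] by simp
    qed
    define \<phi> where "\<phi> x = P x - P a" for x
    have D: "(\<phi> has_real_derivative \<theta> x) (at x)" for x
      unfolding \<phi>_def[abs_def] using P by (auto intro!: derivative_eq_intros)
    have "\<phi> \<in> test_functions a b"
    proof (rule test_functionsI)
      show "smooth \<phi>" by (rule smooth_antideriv[OF D sm\<theta>])
      show "a < c'" "d' < b" using cd1 cd2 by (auto simp: c'_def d'_def)
      then show "\<phi> x = 0" if "x \<notin> {c'..d'}" for x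
      proof (cases "x < c'")
        case True
        \<comment> \<open>\<open>max\<close> and \<open>min\<close> treat x on either side of a at
          once: everything between x and a lies to the left of the support.\<close>
        have "P (max a x) = P (min a x)"
          by (rule const) (use True \<open>a < c'\<close> in \<open>auto intro!: \<theta>0\<close>)
        then show ?thesis by (cases "a \<le> x") (auto simp: \<phi>_def max_def min_def)
      next
        case False
        \<comment> \<open>To the right of the support the primitive keeps its value at b, which by
          \<open>Pab\<close> is its value at a; this is where mean zero enters.\<close>
        have "P (max b x) = P (min b x)"
          by (rule const) (use False that \<open>d' < b\<close> in \<open>auto intro!: \<theta>0\<close>)
        then show ?thesis using Pab by (cases "b \<le> x") (auto simp: \<phi>_def max_def min_def)
      qed
    qed
    from z[OF this] have "(LINT x|?M. h x * \<theta> x) = 0"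
      using DERIV_imp_deriv[OF D] by simp
    moreover have "(LINT x|?M. h x * \<theta> x) = (LINT x|?M. h x * \<psi> x) - k * (LINT x|?M. h x * \<psi>0 x)"
      using integrable_mult_continuous[OF h smooth_continuous_on[OF sm]]
        integrable_mult_continuous[OF h smooth_continuous_on[OF sm0]]
      by (simp add: \<theta>_def right_diff_distrib mult.left_commute[of _ k])
    moreover have "(LINT x|?M. (h x - c) * \<psi> x) = (LINT x|?M. h x * \<psi> x) - c * (LINT x|?M. \<psi> x)"
      using integrable_mult_continuous[OF h smooth_continuous_on[OF sm]] i
      by (simp add: left_diff_distrib)
    ultimately show "(LINT x|?M. (h x - c) * \<psi> x) = 0"
      by (simp add: c_def k_def)
  qed
  then have "AE x in ?M. h x = c" by eventually_elim simp
  then show ?thesis by (rule that)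
qed

section \<open>Primitives of first and second order\<close>

definition primitive :: "real \<Rightarrow> real \<Rightarrow> (real \<Rightarrow> real) \<Rightarrow> real \<Rightarrow> real" where
  "primitive a c g x = c + (LINT t|lebesgue_on {a..x}. g t)"

lemma primitive_continuous_on:
  "integrable (lebesgue_on {a..b}) g \<Longrightarrow> continuous_on {a..b} (primitive a c g)"
  unfolding primitive_def[abs_def]
  by (intro continuous_intros indefinite_integral_continuous_on)

text \<open>Integration by parts for a merely integrable g is Fubini on the triangle with kernel 1:
  the inner integral of the derivative of \<phi> over {t..b} is -\<phi>(t), because \<phi> vanishes
  at b.\<close>

lemma has_weak_deriv_primitive:
  assumes "a < b" and g: "integrable (lebesgue_on {a..b}) g"
  shows "has_weak_deriv a b (primitive a c g) g"
  unfolding has_weak_deriv_def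
proof (intro conjI ballI g)
  let ?M = "lebesgue_on {a..b}"
  show "integrable ?M (primitive a c g)"
    by (rule continuous_imp_integrable_real[OF primitive_continuous_on[OF g]])
  fix \<phi> assume \<phi>: "\<phi> \<in> test_functions a b"
  have sm: "smooth \<phi>" by (rule test_functions_smooth[OF \<phi>])
  have cd: "continuous_on S (deriv \<phi>)" for S by (rule smooth_continuous_on[OF smooth_deriv[OF sm]])
  have id: "integrable ?M (deriv \<phi>)" by (rule continuous_imp_integrable_real[OF cd])
  have FTC: "(LINT x|lebesgue_on {t..b}. deriv \<phi> x) = - \<phi> t" if "t \<le> b" for t
    using lebesgue_FTC[OF that smooth_has_derivative[OF sm] cd] test_functions_outside[OF \<phi>, of b]
    by simp
  note F = Fubini_triangle[of a b "deriv \<phi>" g "\<lambda>_ _. 1" 1, OF id g]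
  have "(LINT x|?M. primitive a c g x * deriv \<phi> x)
      = (LINT x|?M. c * deriv \<phi> x + deriv \<phi> x * (LINT t|lebesgue_on {a..x}. g t))"
    by (simp add: primitive_def algebra_simps)
  also have "\<dots> = c * (LINT x|?M. deriv \<phi> x)
      + (LINT x|?M. deriv \<phi> x * (LINT t|lebesgue_on {a..x}. g t))"
    using F(2) id by simp
  also have "(LINT x|?M. deriv \<phi> x) = 0"
    using FTC[of a] assms(1) test_functions_outside[OF \<phi>, of a] by simp
  also have "(LINT x|?M. deriv \<phi> x * (LINT t|lebesgue_on {a..x}. g t))
      = (LINT t|?M. (LINT x|lebesgue_on {t..b}. deriv \<phi> x) * g t)"
    using F(1) by simp
  also have "\<dots> = (LINT t|?M. - (g t * \<phi> t))"
    by (rule Bochner_Integration.integral_cong) (use FTC in auto)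
  finally show "(LINT x|?M. primitive a c g x * deriv \<phi> x) = - (LINT x|?M. g x * \<phi> x)" by simp
qed

text \<open>f and the primitive of g have the same weak derivative, so du Bois-Reymond makes their
  difference constant.\<close>

lemma has_weak_deriv_imp_primitive:
  assumes "a < b" "has_weak_deriv a b f g"
  obtains c where "AE x in lebesgue_on {a..b}. f x = primitive a c g x"
proof -
  let ?M = "lebesgue_on {a..b}"
  have f: "integrable ?M f" and g: "integrable ?M g"
    using assms(2) by (auto simp: has_weak_deriv_def)
  have P: "has_weak_deriv a b (primitive a 0 g) g"
    by (rule has_weak_deriv_primitive[OF assms(1) g])
  then have ip: "integrable ?M (primitive a 0 g)" by (simp add: has_weak_deriv_def)
  have "(LINT x|?M. (f x - primitive a 0 g x) * deriv \<phi> x) = 0" if \<phi>: "\<phi> \<in> test_functions a b" for \<phi>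
  proof -
    have c: "continuous_on {a..b} (deriv \<phi>)"
      by (rule smooth_continuous_on[OF smooth_deriv[OF test_functions_smooth[OF \<phi>]]])
    have "(LINT x|?M. f x * deriv \<phi> x) = (LINT x|?M. primitive a 0 g x * deriv \<phi> x)"
      using assms(2) P \<phi> by (simp add: has_weak_deriv_def)
    then show ?thesis
      using f ip by (simp add: left_diff_distrib integrable_mult_continuous[OF _ c])
  qed
  then obtain c where "AE x in ?M. f x - primitive a 0 g x = c"
    using du_Bois_Reymond[of a b "\<lambda>x. f x - primitive a 0 g x"] f ip assms(1) by auto
  then have "AE x in ?M. f x = primitive a c g x"
    by eventually_elim (simp add: primitive_def)
  then show ?thesis by (rule that)
qed

text \<open>Taylor's formula at a with integral remainder. The remainder is kept as a single
  integral because \<open>op_T1\<close> contains it in this form.\<close>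

definition primitive2 :: "real \<Rightarrow> real \<Rightarrow> real \<Rightarrow> (real \<Rightarrow> real) \<Rightarrow> real \<Rightarrow> real" where
  "primitive2 a c0 c1 w x = c0 + (x - a) * c1 + (LINT t|lebesgue_on {a..x}. (x - t) * w t)"

text \<open>Cauchy's formula for repeated integration: Fubini on the triangle over {a..x} with both
  the outer factor and the kernel equal to 1, the inner integral being the length x - t.\<close>

lemma primitive2_eq_iterated:
  assumes w: "integrable (lebesgue_on {a..b}) w" and x: "x \<in> {a..b}"
  shows "primitive2 a c0 c1 w x = primitive a c0 (primitive a c1 w) x"
proof -
  let ?M = "lebesgue_on {a..x}"
  have w': "integrable ?M w"
    by (rule integrable_lebesgue_on_subinterval[OF w]) (use x in auto)
  note F = Fubini_triangle[of a x "\<lambda>_. 1" w "\<lambda>_ _. 1" 1, OF _ w']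
  have "(LINT s|?M. c1 + (LINT t|lebesgue_on {a..s}. w t))
      = (x - a) * c1 + (LINT s|?M. (LINT t|lebesgue_on {a..s}. w t))"
    using F(2) x by (subst Bochner_Integration.integral_add) (auto simp: measure_restrict_space)
  also have "(LINT s|?M. (LINT t|lebesgue_on {a..s}. w t)) = (LINT t|?M. (x - t) * w t)"
  proof -
    have "(LINT s|?M. (LINT t|lebesgue_on {a..s}. w t)) = (LINT t|?M. (LINT s|lebesgue_on {t..x}. 1) * w t)"
      using F(1) by simp
    also have "\<dots> = (LINT t|?M. (x - t) * w t)"
      by (rule Bochner_Integration.integral_cong) (auto simp: measure_restrict_space)
    finally show ?thesis .
  qed
  finally show ?thesis by (simp add: primitive_def primitive2_def)
qed

lemma integrable_primitive:
  "integrable (lebesgue_on {a..b}) g \<Longrightarrow> integrable (lebesgue_on {a..b}) (primitive a c g)"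
  by (rule continuous_imp_integrable_real[OF primitive_continuous_on])

lemma primitive2_continuous_on:
  assumes w: "integrable (lebesgue_on {a..b}) w"
  shows "continuous_on {a..b} (primitive2 a c0 c1 w)"
  by (rule continuous_on_eq[OF primitive_continuous_on[OF integrable_primitive[OF w]]])
     (simp add: primitive2_eq_iterated[OF w])

text \<open>Evaluates everything that is defined by choice, namely both weak derivatives and the
  point values, in terms of c0, c1 and w.\<close>

lemma AE_eq_primitive2:
  assumes "a < b" and w: "integrable (lebesgue_on {a..b}) w"
    and f: "AE x in lebesgue_on {a..b}. f x = primitive2 a c0 c1 w x"
  shows "has_weak_deriv a b f (primitive a c1 w)"
    and "AE x in lebesgue_on {a..b}. weak_deriv a b f x = primitive a c1 w x"
    and "AE x in lebesgue_on {a..b}. weak_deriv a b (weak_deriv a b f) x = w x"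
    and "x \<in> {a..b} \<Longrightarrow> cont_rep a b f x = primitive2 a c0 c1 w x"
    and "x \<in> {a..b} \<Longrightarrow> cont_rep a b (weak_deriv a b f) x = primitive a c1 w x"
proof -
  let ?M = "lebesgue_on {a..b}"
  have "AE x in ?M. primitive a c0 (primitive a c1 w) x = f x"
    using f AE_space by eventually_elim (simp add: primitive2_eq_iterated[OF w])
  with has_weak_deriv_primitive[OF assms(1) integrable_primitive[OF w]]
  show f1: "has_weak_deriv a b f (primitive a c1 w)"
    by (rule has_weak_deriv_cong_AE)
  show V: "AE x in ?M. weak_deriv a b f x = primitive a c1 w x"
    by (rule weak_deriv_AE_eq(2)[OF assms(1) f1])
  then have "AE x in ?M. primitive a c1 w x = weak_deriv a b f x"
    by eventually_elim simp
  with has_weak_deriv_primitive[OF assms(1) w]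
  have "has_weak_deriv a b (weak_deriv a b f) w"
    by (rule has_weak_deriv_cong_AE)
  then show "AE x in ?M. weak_deriv a b (weak_deriv a b f) x = w x"
    by (rule weak_deriv_AE_eq(2)[OF assms(1)])
  show "x \<in> {a..b} \<Longrightarrow> cont_rep a b f x = primitive2 a c0 c1 w x"
    by (rule cont_rep_eq[OF assms(1) primitive2_continuous_on[OF w] f])
  show "x \<in> {a..b} \<Longrightarrow> cont_rep a b (weak_deriv a b f) x = primitive a c1 w x"
    by (rule cont_rep_eq[OF assms(1) primitive_continuous_on[OF w] V])
qed

lemma has_weak_deriv_imp_primitive2:
  assumes "a < b" "has_weak_deriv a b f f1" "has_weak_deriv a b f1 f2"
  obtains c0 c1 where "AE x in lebesgue_on {a..b}. f x = primitive2 a c0 c1 f2 x"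
proof -
  let ?M = "lebesgue_on {a..b}"
  have f2: "integrable ?M f2" using assms(3) by (simp add: has_weak_deriv_def)
  obtain c1 where c1: "AE x in ?M. f1 x = primitive a c1 f2 x"
    using has_weak_deriv_imp_primitive[OF assms(1,3)] .
  \<comment> \<open>Replacing f1 by its primitive form changes no pairing with a test function, and
    the next application then yields literally an iterated primitive.\<close>
  have "has_weak_deriv a b f (primitive a c1 f2)"
    unfolding has_weak_deriv_def
  proof (intro conjI ballI integrable_primitive[OF f2])
    fix \<phi> assume \<phi>: "\<phi> \<in> test_functions a b"
    have "continuous_on {a..b} \<phi>" by (rule smooth_continuous_on[OF test_functions_smooth[OF \<phi>]])
    then have [measurable]: "\<phi> \<in> borel_measurable ?M" by (rule continuous_on_imp_borel_measurable_lebesgue_on)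
    have [measurable]: "f1 \<in> borel_measurable ?M" "primitive a c1 f2 \<in> borel_measurable ?M"
      using assms(3) integrable_primitive[OF f2] by (auto simp: has_weak_deriv_def)
    have "(LINT x|?M. f1 x * \<phi> x) = (LINT x|?M. primitive a c1 f2 x * \<phi> x)"
      by (rule integral_cong_AE) (use c1 in \<open>auto elim: eventually_mono\<close>)
    then show "(LINT x|?M. f x * deriv \<phi> x) = - (LINT x|?M. primitive a c1 f2 x * \<phi> x)"
      using assms(2) \<phi> by (simp add: has_weak_deriv_def)
  qed (use assms(2) in \<open>simp add: has_weak_deriv_def\<close>)
  from has_weak_deriv_imp_primitive[OF assms(1) this] obtain c0
    where "AE x in ?M. f x = primitive a c0 (primitive a c1 f2) x" .
  then have "AE x in ?M. f x = primitive2 a c0 c1 f2 x"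
    using AE_space by eventually_elim (simp add: primitive2_eq_iterated[OF f2])
  then show ?thesis by (rule that)
qed

section \<open>Vector-valued integrals\<close>

lemma integrable_mult_L2:
  assumes "f \<in> L2 a b" "g \<in> L2 a b"
  shows "integrable (lebesgue_on {a..b}) (\<lambda>x. f x * g x)"
proof (rule Bochner_Integration.integrable_bound[of _ "\<lambda>x. (f x)\<^sup>2 + (g x)\<^sup>2"])
  have "norm (f x * g x) \<le> norm ((f x)\<^sup>2 + (g x)\<^sup>2)" for x
  proof -
    have "2 * \<bar>f x * g x\<bar> \<le> (f x)\<^sup>2 + (g x)\<^sup>2"
      using sum_squares_bound[of "\<bar>f x\<bar>" "\<bar>g x\<bar>"] by (simp add: abs_mult)
    then show ?thesis by simp
  qed
  then show "AE x in lebesgue_on {a..b}. norm (f x * g x) \<le> norm ((f x)\<^sup>2 + (g x)\<^sup>2)" by simp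
qed (use assms in \<open>auto simp: L2_def\<close>)

lemma continuous_in_L2: "continuous_on {a..b} f \<Longrightarrow> f \<in> L2 a b"
  unfolding L2_def
  by (auto intro!: continuous_on_imp_borel_measurable_lebesgue_on continuous_imp_integrable_real continuous_intros)

lemma integrable_L2:
  assumes "f \<in> L2 a b" shows "integrable (lebesgue_on {a..b}) f"
proof -
  have "(\<lambda>_. 1) \<in> L2 a b" by (rule continuous_in_L2) simp
  from integrable_mult_L2[OF assms this] show ?thesis by simp
qed

lemma L2_cong_AE:
  assumes "f \<in> L2 a b" "AE x in lebesgue_on {a..b}. f x = g x"
  shows "g \<in> L2 a b"
proof -
  have "AE x in lebesgue_on {a..b}. (f x)\<^sup>2 = (g x)\<^sup>2"
    using assms(2) by eventually_elim simp
  then have "integrable (lebesgue_on {a..b}) (\<lambda>x. (g x)\<^sup>2)"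
    by (rule integrable_lebesgue_on_cong_AE[rotated]) (use assms(1) in \<open>simp add: L2_def\<close>)
  moreover have "g \<in> borel_measurable (lebesgue_on {a..b})"
    by (rule measurable_lebesgue_on_cong_AE[OF _ assms(2)]) (use assms(1) in \<open>simp add: L2_def\<close>)
  ultimately show ?thesis by (simp add: L2_def)
qed

lemma L2_vec_carrier: "f \<in> L2_vec a b n \<Longrightarrow> x \<in> {a..b} \<Longrightarrow> f x \<in> carrier_vec n"
  and L2_vec_component: "f \<in> L2_vec a b n \<Longrightarrow> i < n \<Longrightarrow> (\<lambda>x. f x $ i) \<in> L2 a b"
  by (auto simp: L2_vec_def)

lemma L2_mat_carrier: "F \<in> L2_mat a b k l \<Longrightarrow> x \<in> {a..b} \<Longrightarrow> F x \<in> carrier_mat k l"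
  and L2_mat_entry: "F \<in> L2_mat a b k l \<Longrightarrow> i < k \<Longrightarrow> j < l \<Longrightarrow> (\<lambda>x. F x $$ (i, j)) \<in> L2 a b"
  by (auto simp: L2_mat_def)

lemma index_mult_mat_vec_sum:
  "A \<in> carrier_mat k l \<Longrightarrow> v \<in> carrier_vec l \<Longrightarrow> i < k \<Longrightarrow>
   (A *\<^sub>v v) $ i = (\<Sum>j<l. A $$ (i, j) * v $ j)"
  by (simp add: scalar_prod_def atLeast0LessThan)

text \<open>The dimension is part of the notion because the componentwise rules for sums and matrix
  products hold only for vectors of matching dimension.\<close>

definition integrable_vec :: "real \<Rightarrow> real \<Rightarrow> nat \<Rightarrow> (real \<Rightarrow> real vec) \<Rightarrow> bool" where
  "integrable_vec a b k f \<longleftrightarrow> (\<forall>x\<in>{a..b}. f x \<in> carrier_vec k) \<and>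
     (\<forall>i<k. integrable (lebesgue_on {a..b}) (\<lambda>x. f x $ i))"

lemma vec_integral_carrier[simp]: "vec_integral k a b f \<in> carrier_vec k"
  by (simp add: vec_integral_def)

lemma vec_integral_dim[simp]: "dim_vec (vec_integral k a b f) = k"
  by (simp add: vec_integral_def)

lemma vec_integral_cong:
  "(\<And>x. x \<in> {a..b} \<Longrightarrow> f x = g x) \<Longrightarrow> vec_integral k a b f = vec_integral k a b g"
  unfolding vec_integral_def
  by (intro eq_vecI) (auto intro!: Bochner_Integration.integral_cong[OF refl])

lemma integrable_vec_cong:
  assumes "integrable_vec a b k f" "\<And>x. x \<in> {a..b} \<Longrightarrow> f x = g x"
  shows "integrable_vec a b k g"
proof -
  have "integrable (lebesgue_on {a..b}) (\<lambda>x. f x $ i) = integrable (lebesgue_on {a..b}) (\<lambda>x. g x $ i)" for i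
    by (rule Bochner_Integration.integrable_cong) (use assms(2) in auto)
  then show ?thesis using assms by (simp add: integrable_vec_def)
qed

lemma vec_integral_cong_AE:
  assumes f: "integrable_vec a b k f" and "AE x in lebesgue_on {a..b}. f x = g x"
  shows "vec_integral k a b f = vec_integral k a b g"
proof (rule eq_vecI)
  fix i assume "i < dim_vec (vec_integral k a b g)"
  then have i: "i < k" by simp
  have ae: "AE x in lebesgue_on {a..b}. f x $ i = g x $ i"
    using assms(2) by eventually_elim simp
  have "(\<lambda>x. f x $ i) \<in> borel_measurable (lebesgue_on {a..b})"
    using f i by (auto simp: integrable_vec_def)
  then show "vec_integral k a b f $ i = vec_integral k a b g $ i"
    using i integral_cong_AE[OF _ measurable_lebesgue_on_cong_AE[OF _ ae] ae]
    by (simp add: vec_integral_def)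
qed simp

lemma vec_integral_add:
  assumes "integrable_vec a b k f" "integrable_vec a b k g"
  shows "vec_integral k a b (\<lambda>x. f x + g x) = vec_integral k a b f + vec_integral k a b g"
    and "integrable_vec a b k (\<lambda>x. f x + g x)"
proof -
  have e: "(f x + g x) $ i = f x $ i + g x $ i" if "x \<in> {a..b}" "i < k" for x i
  proof -
    have "g x \<in> carrier_vec k" using assms(2) that by (simp add: integrable_vec_def)
    then show ?thesis using that by simp
  qed
  have c: "integrable (lebesgue_on {a..b}) (\<lambda>x. (f x + g x) $ i)
      \<longleftrightarrow> integrable (lebesgue_on {a..b}) (\<lambda>x. f x $ i + g x $ i)" if "i < k" for i
    by (rule Bochner_Integration.integrable_cong) (use e that in auto)
  have l: "(LINT x|lebesgue_on {a..b}. (f x + g x) $ i)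
      = (LINT x|lebesgue_on {a..b}. f x $ i + g x $ i)" if "i < k" for i
    by (rule Bochner_Integration.integral_cong) (use e that in auto)
  show "vec_integral k a b (\<lambda>x. f x + g x) = vec_integral k a b f + vec_integral k a b g"
    by (rule eq_vecI) (use assms l in \<open>auto simp: vec_integral_def integrable_vec_def\<close>)
  show "integrable_vec a b k (\<lambda>x. f x + g x)"
    using assms c by (auto simp: integrable_vec_def)
qed

lemma vec_integral_mult_const:
  assumes A: "A \<in> carrier_mat k l" and f: "integrable_vec a b l f"
  shows "vec_integral k a b (\<lambda>x. A *\<^sub>v f x) = A *\<^sub>v vec_integral l a b f"
    and "integrable_vec a b k (\<lambda>x. A *\<^sub>v f x)"
proof -
  have fc: "f x \<in> carrier_vec l" if "x \<in> {a..b}" for x using f that by (simp add: integrable_vec_def)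
  have fi: "integrable (lebesgue_on {a..b}) (\<lambda>x. f x $ j)" if "j < l" for j
    using f that by (simp add: integrable_vec_def)
  have c: "integrable (lebesgue_on {a..b}) (\<lambda>x. (A *\<^sub>v f x) $ i)
      \<longleftrightarrow> integrable (lebesgue_on {a..b}) (\<lambda>x. \<Sum>j<l. A $$ (i, j) * f x $ j)" if "i < k" for i
    by (rule Bochner_Integration.integrable_cong)
       (use fc that in \<open>auto simp: index_mult_mat_vec_sum[OF A] simp del: index_mult_mat_vec\<close>)
  have e: "(LINT x|lebesgue_on {a..b}. (A *\<^sub>v f x) $ i)
      = (LINT x|lebesgue_on {a..b}. (\<Sum>j<l. A $$ (i, j) * f x $ j))" if "i < k" for i
    by (rule Bochner_Integration.integral_cong)
       (use fc that in \<open>auto simp: index_mult_mat_vec_sum[OF A] simp del: index_mult_mat_vec\<close>)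
  show "integrable_vec a b k (\<lambda>x. A *\<^sub>v f x)"
    unfolding integrable_vec_def using c fi fc A by auto
  show "vec_integral k a b (\<lambda>x. A *\<^sub>v f x) = A *\<^sub>v vec_integral l a b f"
  proof (rule eq_vecI)
    fix i assume "i < dim_vec (A *\<^sub>v vec_integral l a b f)"
    then have i: "i < k" using A by simp
    have "vec_integral k a b (\<lambda>x. A *\<^sub>v f x) $ i = (\<Sum>j<l. A $$ (i, j) * (LINT x|lebesgue_on {a..b}. f x $ j))"
      using i e[OF i] fi by (simp add: vec_integral_def)
    also have "\<dots> = (A *\<^sub>v vec_integral l a b f) $ i"
      by (subst index_mult_mat_vec_sum[OF A _ i]) (auto simp: vec_integral_def)
    finally show "vec_integral k a b (\<lambda>x. A *\<^sub>v f x) $ i = (A *\<^sub>v vec_integral l a b f) $ i" .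
  qed (use A in auto)
qed

lemma mat_integral_mult_vec:
  assumes A: "\<And>x. x \<in> {a..b} \<Longrightarrow> A x \<in> carrier_mat k l"
    and int: "\<And>i j. i < k \<Longrightarrow> j < l \<Longrightarrow> integrable (lebesgue_on {a..b}) (\<lambda>x. A x $$ (i, j))"
    and c: "c \<in> carrier_vec l"
  shows "mat_integral k l a b A *\<^sub>v c = vec_integral k a b (\<lambda>x. A x *\<^sub>v c)"
    and "integrable_vec a b k (\<lambda>x. A x *\<^sub>v c)"
proof -
  have cc: "integrable (lebesgue_on {a..b}) (\<lambda>x. (A x *\<^sub>v c) $ i)
      \<longleftrightarrow> integrable (lebesgue_on {a..b}) (\<lambda>x. \<Sum>j<l. A x $$ (i, j) * c $ j)" if "i < k" for i
    by (rule Bochner_Integration.integrable_cong)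
       (use A that in \<open>auto simp: index_mult_mat_vec_sum[OF A c] simp del: index_mult_mat_vec\<close>)
  have e: "(LINT x|lebesgue_on {a..b}. (A x *\<^sub>v c) $ i)
      = (LINT x|lebesgue_on {a..b}. (\<Sum>j<l. A x $$ (i, j) * c $ j))" if "i < k" for i
    by (rule Bochner_Integration.integral_cong)
       (use A that in \<open>auto simp: index_mult_mat_vec_sum[OF A c] simp del: index_mult_mat_vec\<close>)
  have M: "mat_integral k l a b A \<in> carrier_mat k l" by (simp add: mat_integral_def)
  show "integrable_vec a b k (\<lambda>x. A x *\<^sub>v c)"
    unfolding integrable_vec_def
  proof (intro conjI ballI allI impI)
    show "A x *\<^sub>v c \<in> carrier_vec k" if "x \<in> {a..b}" for x
      using mult_mat_vec_carrier[OF A[OF that] c] .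
    show "integrable (lebesgue_on {a..b}) (\<lambda>x. (A x *\<^sub>v c) $ i)" if "i < k" for i
      unfolding cc[OF that]
      by (intro Bochner_Integration.integrable_sum integrable_mult_left int that) simp
  qed
  show "mat_integral k l a b A *\<^sub>v c = vec_integral k a b (\<lambda>x. A x *\<^sub>v c)"
  proof (rule eq_vecI)
    fix i assume "i < dim_vec (vec_integral k a b (\<lambda>x. A x *\<^sub>v c))"
    then have i: "i < k" by simp
    have "(mat_integral k l a b A *\<^sub>v c) $ i
        = (\<Sum>j<l. (LINT x|lebesgue_on {a..b}. A x $$ (i, j)) * c $ j)"
      unfolding index_mult_mat_vec_sum[OF M c i] using i by (simp add: mat_integral_def)
    also have "\<dots> = vec_integral k a b (\<lambda>x. A x *\<^sub>v c) $ i"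
      using i e[OF i] int by (simp add: vec_integral_def)
    finally show "(mat_integral k l a b A *\<^sub>v c) $ i = vec_integral k a b (\<lambda>x. A x *\<^sub>v c) $ i" .
  qed (use M in auto)
qed

lemma vec_integral_append:
  assumes "integrable_vec a b k f" "integrable_vec a b l g"
  shows "vec_integral (k + l) a b (\<lambda>x. f x @\<^sub>v g x) = vec_integral k a b f @\<^sub>v vec_integral l a b g"
    and "integrable_vec a b (k + l) (\<lambda>x. f x @\<^sub>v g x)"
proof -
  have c: "f x \<in> carrier_vec k" "g x \<in> carrier_vec l" if "x \<in> {a..b}" for x
    using assms that by (auto simp: integrable_vec_def)
  have ix: "(f x @\<^sub>v g x) $ i = (if i < k then f x $ i else g x $ (i - k))"
    if "x \<in> {a..b}" "i < k + l" for x i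
    using c[OF that(1)] that(2) by auto
  have e: "(LINT x|lebesgue_on {a..b}. (f x @\<^sub>v g x) $ i)
     = (LINT x|lebesgue_on {a..b}. (if i < k then f x $ i else g x $ (i - k)))" if "i < k + l" for i
    by (rule Bochner_Integration.integral_cong) (use ix that in auto)
  have cc: "integrable (lebesgue_on {a..b}) (\<lambda>x. (f x @\<^sub>v g x) $ i)
     \<longleftrightarrow> integrable (lebesgue_on {a..b}) (\<lambda>x. if i < k then f x $ i else g x $ (i - k))"
    if "i < k + l" for i
    by (rule Bochner_Integration.integrable_cong) (use ix that in auto)
  show "vec_integral (k + l) a b (\<lambda>x. f x @\<^sub>v g x) = vec_integral k a b f @\<^sub>v vec_integral l a b g"
    by (rule eq_vecI) (auto simp: vec_integral_def e)
  show "integrable_vec a b (k + l) (\<lambda>x. f x @\<^sub>v g x)"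
    unfolding integrable_vec_def
  proof (intro conjI ballI allI impI)
    show "integrable (lebesgue_on {a..b}) (\<lambda>x. (f x @\<^sub>v g x) $ i)" if i: "i < k + l" for i
      unfolding cc[OF i] using assms i by (cases "i < k") (auto simp: integrable_vec_def)
  qed (use c in auto)
qed

lemma append_cols_mult:
  assumes "A \<in> carrier_mat k p" "B \<in> carrier_mat k q" "c \<in> carrier_vec p" "d \<in> carrier_vec q"
  shows "(A @\<^sub>c B) *\<^sub>v (c @\<^sub>v d) = A *\<^sub>v c + B *\<^sub>v d"
proof -
  \<comment> \<open>Side by side matrices are block matrices whose lower blocks have no rows, so the
    lower half of the product is an empty vector.\<close>
  have "(A @\<^sub>c B) *\<^sub>v (c @\<^sub>v d) = (A *\<^sub>v c + B *\<^sub>v d) @\<^sub>v (0\<^sub>m 0 p *\<^sub>v c + 0\<^sub>m 0 q *\<^sub>v d)"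
    unfolding append_cols_def using assms
    by (subst four_block_mat_mult_vec[of A k p B q _ 0]) auto
  then show ?thesis using assms by auto
qed

lemma append_cols_carrier:
  "A \<in> carrier_mat k p \<Longrightarrow> B \<in> carrier_mat k q \<Longrightarrow> A @\<^sub>c B \<in> carrier_mat k (p + q)"
  unfolding append_cols_def by auto

lemma affine_row_carrier: "affine_row a n x \<in> carrier_mat n (2 * n)"
  unfolding affine_row_def mult_2 by (rule append_cols_carrier) auto

lemma smult_one_mult_vec: "(v :: real vec) \<in> carrier_vec n \<Longrightarrow> (k \<cdot>\<^sub>m 1\<^sub>m n) *\<^sub>v v = k \<cdot>\<^sub>v v"
  by (intro eq_vecI) (auto simp: index_mult_mat_vec_sum[of _ n n] if_distrib sum.delta cong: if_cong)

lemma affine_row_mult: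
  assumes "c0 \<in> carrier_vec n" "c1 \<in> carrier_vec n"
  shows "affine_row a n x *\<^sub>v (c0 @\<^sub>v c1) = c0 + (x - a) \<cdot>\<^sub>v c1"
  unfolding affine_row_def using assms
  by (subst append_cols_mult[of _ n n _ n]) (auto simp: smult_one_mult_vec)

section \<open>The space \<open>W2\<close>\<close>

definition primitive_vec :: "real \<Rightarrow> nat \<Rightarrow> real vec \<Rightarrow> (real \<Rightarrow> real vec) \<Rightarrow> real \<Rightarrow> real vec" where
  "primitive_vec a n c g x = vec n (\<lambda>i. primitive a (c $ i) (\<lambda>t. g t $ i) x)"

definition primitive2_vec ::
  "real \<Rightarrow> nat \<Rightarrow> real vec \<Rightarrow> real vec \<Rightarrow> (real \<Rightarrow> real vec) \<Rightarrow> real \<Rightarrow> real vec" where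
  "primitive2_vec a n c0 c1 w x = vec n (\<lambda>i. primitive2 a (c0 $ i) (c1 $ i) (\<lambda>t. w t $ i) x)"

text \<open>The counterpart of \<open>boundary_values\<close> in which no chosen representative
  occurs.\<close>

definition primitive2_values ::
  "real \<Rightarrow> real \<Rightarrow> nat \<Rightarrow> real vec \<Rightarrow> real vec \<Rightarrow> (real \<Rightarrow> real vec) \<Rightarrow> real vec" where
  "primitive2_values a b n c0 c1 w =
     primitive2_vec a n c0 c1 w a @\<^sub>v primitive2_vec a n c0 c1 w b @\<^sub>v
     primitive_vec a n c1 w a @\<^sub>v primitive_vec a n c1 w b"

lemma primitive2_vec_carrier[simp]: "primitive2_vec a n c0 c1 w x \<in> carrier_vec n"
  by (simp add: primitive2_vec_def)

lemma AE_eq_primitive2_vec: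
  assumes "a < b" and w: "w \<in> L2_vec a b n"
    and u: "AE x in lebesgue_on {a..b}. u x = primitive2_vec a n c0 c1 w x"
  shows "boundary_values a b n u = primitive2_values a b n c0 c1 w"
    and "AE x in lebesgue_on {a..b}. weak_deriv_vec a b n (weak_deriv_vec a b n u) x = w x"
proof -
  have wi: "integrable (lebesgue_on {a..b}) (\<lambda>t. w t $ i)" if "i < n" for i
    by (rule integrable_L2[OF L2_vec_component[OF w that]])
  have ui: "AE x in lebesgue_on {a..b}. u x $ i = primitive2 a (c0 $ i) (c1 $ i) (\<lambda>t. w t $ i) x"
    if "i < n" for i
    using u by eventually_elim (use that in \<open>simp add: primitive2_vec_def\<close>)
  note P = AE_eq_primitive2[OF assms(1) wi ui]
  have W: "(\<lambda>y. weak_deriv_vec a b n u y $ i) = weak_deriv a b (\<lambda>y. u y $ i)" if "i < n" for u i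
    using that by (auto simp: weak_deriv_vec_def)
  have "point_value a b n u x = primitive2_vec a n c0 c1 w x" if "x \<in> {a..b}" for x
    by (rule eq_vecI) (use P(4)[OF _ _ that] in \<open>auto simp: point_value_def primitive2_vec_def\<close>)
  moreover have "point_value a b n (weak_deriv_vec a b n u) x = primitive_vec a n c1 w x"
    if "x \<in> {a..b}" for x
    by (rule eq_vecI) (use P(5)[OF _ _ that] in \<open>auto simp: point_value_def primitive_vec_def W\<close>)
  ultimately show "boundary_values a b n u = primitive2_values a b n c0 c1 w"
    using assms(1) by (simp add: boundary_values_def primitive2_values_def)
  \<comment> \<open>There are finitely many components, so their exceptional sets unite to a null
    set.\<close>
  have "AE x in lebesgue_on {a..b}. \<forall>i\<in>{..<n}.
      weak_deriv a b (weak_deriv a b (\<lambda>y. u y $ i)) x = w x $ i"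
    by (intro eventually_ball_finite ballI P(3)) auto
  then show "AE x in lebesgue_on {a..b}. weak_deriv_vec a b n (weak_deriv_vec a b n u) x = w x"
    using AE_space
  proof eventually_elim
    case (elim x)
    then have "w x \<in> carrier_vec n" by (intro L2_vec_carrier[OF w]) simp
    then show ?case
      by (intro eq_vecI) (use elim in \<open>auto simp: W weak_deriv_vec_def[of a b n "weak_deriv_vec a b n u"]\<close>)
  qed
qed

lemma L2_vec_primitive2_vec:
  assumes w: "w \<in> L2_vec a b n"
  shows "primitive2_vec a n c0 c1 w \<in> L2_vec a b n"
  unfolding L2_vec_def
  by (auto simp: primitive2_vec_def integrable_L2[OF L2_vec_component[OF w]]
      intro!: continuous_in_L2 primitive2_continuous_on)

text \<open>Equality is assumed at every point of the interval because \<open>L2_vec\<close>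
  prescribes the dimension of the values everywhere, not just almost everywhere.\<close>

lemma W2_primitive2_vec:
  assumes "a < b" and w: "w \<in> L2_vec a b n"
    and u: "\<And>x. x \<in> {a..b} \<Longrightarrow> u x = primitive2_vec a n c0 c1 w x"
  shows "u \<in> W2 a b n"
proof -
  let ?M = "lebesgue_on {a..b}"
  have wi: "integrable ?M (\<lambda>t. w t $ i)" if "i < n" for i
    by (rule integrable_L2[OF L2_vec_component[OF w that]])
  have ui: "AE x in ?M. u x $ i = primitive2 a (c0 $ i) (c1 $ i) (\<lambda>t. w t $ i) x"
    if "i < n" for i
    by (rule AE_I2) (use u that in \<open>simp add: primitive2_vec_def\<close>)
  have "(\<lambda>x. u x $ i) \<in> L2 a b" if "i < n" for i
  proof (rule L2_cong_AE)
    show "(\<lambda>x. primitive2_vec a n c0 c1 w x $ i) \<in> L2 a b"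
      by (rule L2_vec_component[OF L2_vec_primitive2_vec[OF w] that])
    show "AE x in ?M. primitive2_vec a n c0 c1 w x $ i = u x $ i"
      by (rule AE_I2) (use u in simp)
  qed
  then have "u \<in> L2_vec a b n" using u by (auto simp: L2_vec_def)
  moreover have "primitive_vec a n c1 w \<in> L2_vec a b n"
    unfolding L2_vec_def
    by (auto simp: primitive_vec_def wi intro!: continuous_in_L2 primitive_continuous_on)
  moreover have "has_weak_deriv_vec a b n u (primitive_vec a n c1 w)"
    unfolding has_weak_deriv_vec_def
    using AE_eq_primitive2(1)[OF assms(1) wi ui] by (simp add: primitive_vec_def)
  moreover have "has_weak_deriv_vec a b n (primitive_vec a n c1 w) w"
    unfolding has_weak_deriv_vec_def
    using has_weak_deriv_primitive[OF assms(1) wi] by (simp add: primitive_vec_def)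
  ultimately show ?thesis using w unfolding W2_def by blast
qed

lemma W2_imp_primitive2_vec:
  assumes "a < b" and u: "u \<in> W2 a b n"
  defines "w \<equiv> weak_deriv_vec a b n (weak_deriv_vec a b n u)"
  shows "w \<in> L2_vec a b n"
    and "\<exists>c0\<in>carrier_vec n. \<exists>c1\<in>carrier_vec n.
           AE x in lebesgue_on {a..b}. u x = primitive2_vec a n c0 c1 w x"
proof -
  let ?M = "lebesgue_on {a..b}"
  obtain ux uxx where uL: "u \<in> L2_vec a b n" and uxx: "uxx \<in> L2_vec a b n"
    and d: "\<And>i. i < n \<Longrightarrow> has_weak_deriv a b (\<lambda>x. u x $ i) (\<lambda>x. ux x $ i)"
      "\<And>i. i < n \<Longrightarrow> has_weak_deriv a b (\<lambda>x. ux x $ i) (\<lambda>x. uxx x $ i)"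
    using u unfolding W2_def has_weak_deriv_vec_def by blast
  have wc: "w x $ i = weak_deriv a b (weak_deriv a b (\<lambda>y. u y $ i)) x" if "i < n" for i x
    using that by (simp add: w_def weak_deriv_vec_def)
  have D1: "has_weak_deriv a b (\<lambda>x. u x $ i) (weak_deriv a b (\<lambda>y. u y $ i))" if "i < n" for i
    by (rule weak_deriv_AE_eq(1)[OF assms(1) d(1)[OF that]])
  \<comment> \<open>The second derivative of the witness \<open>ux\<close> is carried over to the
    chosen first derivative, which equals \<open>ux\<close> almost everywhere.\<close>
  have D2': "has_weak_deriv a b (weak_deriv a b (\<lambda>y. u y $ i)) (\<lambda>x. uxx x $ i)" if "i < n" for i
  proof (rule has_weak_deriv_cong_AE[OF d(2)[OF that]])
    show "AE x in ?M. ux x $ i = weak_deriv a b (\<lambda>y. u y $ i) x"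
      using weak_deriv_AE_eq(2)[OF assms(1) d(1)[OF that]] by eventually_elim simp
  qed
  have D2: "has_weak_deriv a b (weak_deriv a b (\<lambda>y. u y $ i)) (\<lambda>x. w x $ i)" if "i < n" for i
    unfolding wc[OF that] by (rule weak_deriv_AE_eq(1)[OF assms(1) D2'[OF that]])
  \<comment> \<open>A chosen weak derivative is a priori only integrable; square integrability comes
    from its agreement with the witness \<open>uxx\<close>.\<close>
  have "(\<lambda>x. w x $ i) \<in> L2 a b" if "i < n" for i
    by (rule L2_cong_AE[OF L2_vec_component[OF uxx that]
          has_weak_deriv_unique[OF assms(1) D2'[OF that] D2[OF that]]])
  then show "w \<in> L2_vec a b n"
    by (auto simp: L2_vec_def w_def weak_deriv_vec_def[of a b n "weak_deriv_vec a b n u"])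
  have "\<exists>c0 c1. AE x in ?M. u x $ i = primitive2 a c0 c1 (\<lambda>t. w t $ i) x" if "i < n" for i
    using has_weak_deriv_imp_primitive2[OF assms(1) D1[OF that] D2[OF that]] by blast
  then obtain c0 c1 where c:
    "\<And>i. i < n \<Longrightarrow> AE x in ?M. u x $ i = primitive2 a (c0 i) (c1 i) (\<lambda>t. w t $ i) x"
    by metis
  have "AE x in ?M. \<forall>i\<in>{..<n}. u x $ i = primitive2 a (c0 i) (c1 i) (\<lambda>t. w t $ i) x"
    by (intro eventually_ball_finite ballI c) auto
  then have "AE x in ?M. u x = primitive2_vec a n (vec n c0) (vec n c1) w x"
    using AE_space
  proof eventually_elim
    case (elim x)
    then have "u x \<in> carrier_vec n" by (intro L2_vec_carrier[OF uL]) simp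
    then show ?case
      by (intro eq_vecI) (use elim in \<open>auto simp: primitive2_vec_def\<close>)
  qed
  then show "\<exists>c0\<in>carrier_vec n. \<exists>c1\<in>carrier_vec n.
      AE x in ?M. u x = primitive2_vec a n c0 c1 w x"
    by (meson vec_carrier)
qed

section \<open>Integrating a second-order primitive against a square integrable kernel\<close>

lemma L2_times_primitive2:
  assumes f: "f \<in> L2 a b" and w: "w \<in> L2 a b"
  shows "(LINT x|lebesgue_on {a..b}. f x * primitive2 a c0 c1 w x)
       = (LINT x|lebesgue_on {a..b}. f x * (c0 + (x - a) * c1))
         + (LINT t|lebesgue_on {a..b}. (LINT x|lebesgue_on {t..b}. (x - t) * f x) * w t)"
    and "integrable (lebesgue_on {a..b}) (\<lambda>t. (LINT x|lebesgue_on {t..b}. (x - t) * f x) * w t)"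
proof -
  have meas: "(\<lambda>(x, t). x - t) \<in> borel_measurable (borel :: (real \<times> real) measure)"
    unfolding case_prod_beta by (intro borel_measurable_continuous_onI continuous_intros)
  \<comment> \<open>The constant b - a bounds |x - t| on the whole square.\<close>
  note F = Fubini_triangle[of a b f w "\<lambda>x t. x - t" "b - a",
      OF integrable_L2[OF f] integrable_L2[OF w] meas]
  have F2: "integrable (lebesgue_on {a..b}) (\<lambda>x. f x * (LINT t|lebesgue_on {a..x}. (x - t) * w t))"
    by (rule F(2)) auto
  have i: "integrable (lebesgue_on {a..b}) (\<lambda>x. f x * (c0 + (x - a) * c1))"
    by (intro integrable_mult_continuous integrable_L2[OF f] continuous_intros)
  have "(LINT x|lebesgue_on {a..b}. f x * primitive2 a c0 c1 w x)
      = (LINT x|lebesgue_on {a..b}. f x * (c0 + (x - a) * c1)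
          + f x * (LINT t|lebesgue_on {a..x}. (x - t) * w t))"
    by (simp add: primitive2_def distrib_left)
  also have "\<dots> = (LINT x|lebesgue_on {a..b}. f x * (c0 + (x - a) * c1))
      + (LINT x|lebesgue_on {a..b}. f x * (LINT t|lebesgue_on {a..x}. (x - t) * w t))"
    by (rule Bochner_Integration.integral_add[OF i F2])
  also have "(LINT x|lebesgue_on {a..b}. f x * (LINT t|lebesgue_on {a..x}. (x - t) * w t))
      = (LINT t|lebesgue_on {a..b}. (LINT x|lebesgue_on {t..b}. (x - t) * f x) * w t)"
    by (rule F(1)) auto
  finally show "(LINT x|lebesgue_on {a..b}. f x * primitive2 a c0 c1 w x)
       = (LINT x|lebesgue_on {a..b}. f x * (c0 + (x - a) * c1))
         + (LINT t|lebesgue_on {a..b}. (LINT x|lebesgue_on {t..b}. (x - t) * f x) * w t)" .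
  show "integrable (lebesgue_on {a..b}) (\<lambda>t. (LINT x|lebesgue_on {t..b}. (x - t) * f x) * w t)"
    by (rule F(3)) auto
qed

lemma integrable_vec_L2_mult:
  assumes F: "F \<in> L2_mat a b k n" and u: "u \<in> L2_vec a b n"
  shows "integrable_vec a b k (\<lambda>x. F x *\<^sub>v u x)"
    and "i < k \<Longrightarrow> vec_integral k a b (\<lambda>x. F x *\<^sub>v u x) $ i
           = (\<Sum>j<n. LINT x|lebesgue_on {a..b}. F x $$ (i, j) * u x $ j)"
proof -
  let ?M = "lebesgue_on {a..b}"
  have e: "(F x *\<^sub>v u x) $ i = (\<Sum>j<n. F x $$ (i, j) * u x $ j)" if "x \<in> {a..b}" "i < k" for x i
    by (rule index_mult_mat_vec_sum[OF L2_mat_carrier[OF F that(1)] L2_vec_carrier[OF u that(1)] that(2)])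
  have int: "integrable ?M (\<lambda>x. F x $$ (i, j) * u x $ j)" if "i < k" "j < n" for i j
    by (rule integrable_mult_L2[OF L2_mat_entry[OF F that] L2_vec_component[OF u that(2)]])
  have ii: "integrable ?M (\<lambda>x. (F x *\<^sub>v u x) $ i)" if i: "i < k" for i
  proof -
    have "integrable ?M (\<lambda>x. \<Sum>j<n. F x $$ (i, j) * u x $ j)"
      by (intro Bochner_Integration.integrable_sum int i) simp
    then show ?thesis
      by (rule Bochner_Integration.integrable_cong[THEN iffD1, rotated -1]) (use e[OF _ i] in auto)
  qed
  then show "integrable_vec a b k (\<lambda>x. F x *\<^sub>v u x)"
    unfolding integrable_vec_def
    using mult_mat_vec_carrier[OF L2_mat_carrier[OF F] L2_vec_carrier[OF u]] by blast
  assume i: "i < k"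
  have "(LINT x|?M. (F x *\<^sub>v u x) $ i) = (LINT x|?M. (\<Sum>j<n. F x $$ (i, j) * u x $ j))"
    by (rule Bochner_Integration.integral_cong[OF refl]) (rule e[OF _ i], simp)
  also have "\<dots> = (\<Sum>j<n. LINT x|?M. F x $$ (i, j) * u x $ j)"
    by (rule Bochner_Integration.integral_sum) (use int[OF i] in simp)
  finally show "vec_integral k a b (\<lambda>x. F x *\<^sub>v u x) $ i
      = (\<Sum>j<n. LINT x|?M. F x $$ (i, j) * u x $ j)"
    using i by (simp add: vec_integral_def)
qed

text \<open>The integral term of \<open>H_mat\<close> without its sign, kept apart because it arises
  from Fubini while the other term of \<open>H_mat\<close> comes from the boundary values.\<close>

definition moment_mat :: "nat \<Rightarrow> nat \<Rightarrow> real \<Rightarrow> (real \<Rightarrow> real mat) \<Rightarrow> real \<Rightarrow> real mat" where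
  "moment_mat k n b F x = mat_integral k n x b (\<lambda>\<theta>. (\<theta> - x) \<cdot>\<^sub>m F \<theta>)"

lemma moment_mat_carrier[simp]: "moment_mat k n b F x \<in> carrier_mat k n"
  by (simp add: moment_mat_def mat_integral_def)

lemma moment_mat_index:
  assumes F: "F \<in> L2_mat a b k n" and "x \<in> {a..b}" "i < k" "j < n"
  shows "moment_mat k n b F x $$ (i, j) = (LINT t|lebesgue_on {x..b}. (t - x) * F t $$ (i, j))"
proof -
  have "((t - x) \<cdot>\<^sub>m F t) $$ (i, j) = (t - x) * F t $$ (i, j)" if "t \<in> {x..b}" for t
  proof -
    have "F t \<in> carrier_mat k n"
      by (rule L2_mat_carrier[OF F]) (use that assms(2) in auto)
    then show ?thesis using assms(3,4) by simp
  qed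
  then have "(LINT t|lebesgue_on {x..b}. ((t - x) \<cdot>\<^sub>m F t) $$ (i, j))
      = (LINT t|lebesgue_on {x..b}. (t - x) * F t $$ (i, j))"
    by (intro Bochner_Integration.integral_cong refl) simp
  then show ?thesis using assms(3,4) by (simp add: moment_mat_def mat_integral_def)
qed

lemma integral_mult_primitive2_vec:
  assumes F: "F \<in> L2_mat a b k n" and w: "w \<in> L2_vec a b n"
    and c: "c0 \<in> carrier_vec n" "c1 \<in> carrier_vec n"
  shows "vec_integral k a b (\<lambda>x. F x *\<^sub>v primitive2_vec a n c0 c1 w x)
       = vec_integral k a b (\<lambda>x. F x *\<^sub>v (c0 + (x - a) \<cdot>\<^sub>v c1))
         + vec_integral k a b (\<lambda>t. moment_mat k n b F t *\<^sub>v w t)" (is ?eq)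
    and "integrable_vec a b k (\<lambda>t. moment_mat k n b F t *\<^sub>v w t)" (is ?int)
    and "integrable_vec a b k (\<lambda>x. F x *\<^sub>v (c0 + (x - a) \<cdot>\<^sub>v c1))"
proof -
  let ?M = "lebesgue_on {a..b}"
  let ?m = "\<lambda>i j t. (LINT x|lebesgue_on {t..b}. (x - t) * F x $$ (i, j))"
  have me: "(moment_mat k n b F t *\<^sub>v w t) $ i = (\<Sum>j<n. ?m i j t * w t $ j)"
    if "t \<in> {a..b}" "i < k" for t i
    unfolding index_mult_mat_vec_sum[OF moment_mat_carrier L2_vec_carrier[OF w that(1)] that(2)]
    using moment_mat_index[OF F that] by simp
  have mint: "integrable ?M (\<lambda>t. ?m i j t * w t $ j)" if "i < k" "j < n" for i j
    by (rule L2_times_primitive2(2)[OF L2_mat_entry[OF F that] L2_vec_component[OF w that(2)]])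
  have mi: "integrable ?M (\<lambda>t. (moment_mat k n b F t *\<^sub>v w t) $ i)" if i: "i < k" for i
  proof -
    have "integrable ?M (\<lambda>t. \<Sum>j<n. ?m i j t * w t $ j)"
      by (intro Bochner_Integration.integrable_sum mint i) simp
    then show ?thesis
      by (rule Bochner_Integration.integrable_cong[THEN iffD1, rotated -1]) (use me[OF _ i] in auto)
  qed
  then show ?int
    unfolding integrable_vec_def
    using mult_mat_vec_carrier[OF moment_mat_carrier L2_vec_carrier[OF w]] by blast
  have mv: "vec_integral k a b (\<lambda>t. moment_mat k n b F t *\<^sub>v w t) $ i
      = (\<Sum>j<n. LINT t|?M. ?m i j t * w t $ j)" if i: "i < k" for i
  proof -
    have "(LINT t|?M. (moment_mat k n b F t *\<^sub>v w t) $ i) = (LINT t|?M. (\<Sum>j<n. ?m i j t * w t $ j))"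
      by (rule Bochner_Integration.integral_cong[OF refl]) (rule me[OF _ i], simp)
    also have "\<dots> = (\<Sum>j<n. LINT t|?M. ?m i j t * w t $ j)"
      by (rule Bochner_Integration.integral_sum) (use mint[OF i] in simp)
    finally show ?thesis using i by (simp add: vec_integral_def)
  qed
  have A: "(\<lambda>x. c0 + (x - a) \<cdot>\<^sub>v c1) \<in> L2_vec a b n"
    unfolding L2_vec_def using c by (auto intro!: continuous_in_L2 continuous_intros)
  show "integrable_vec a b k (\<lambda>x. F x *\<^sub>v (c0 + (x - a) \<cdot>\<^sub>v c1))"
    by (rule integrable_vec_L2_mult(1)[OF F A])
  show ?eq
  proof (rule eq_vecI)
    fix i assume "i < dim_vec (vec_integral k a b (\<lambda>x. F x *\<^sub>v (c0 + (x - a) \<cdot>\<^sub>v c1))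
         + vec_integral k a b (\<lambda>t. moment_mat k n b F t *\<^sub>v w t))"
    then have i: "i < k" by simp
    have "vec_integral k a b (\<lambda>x. F x *\<^sub>v primitive2_vec a n c0 c1 w x) $ i
        = (\<Sum>j<n. LINT x|?M. F x $$ (i, j) * primitive2 a (c0 $ j) (c1 $ j) (\<lambda>t. w t $ j) x)"
      unfolding integrable_vec_L2_mult(2)[OF F L2_vec_primitive2_vec[OF w] i]
      by (simp add: primitive2_vec_def)
    also have "\<dots> = (\<Sum>j<n. (LINT x|?M. F x $$ (i, j) * (c0 $ j + (x - a) * c1 $ j))
        + (LINT t|?M. ?m i j t * w t $ j))"
      by (rule sum.cong[OF refl], rule L2_times_primitive2(1)[OF L2_mat_entry[OF F i] L2_vec_component[OF w]])
         auto
    also have "\<dots> = (\<Sum>j<n. LINT x|?M. F x $$ (i, j) * (c0 + (x - a) \<cdot>\<^sub>v c1) $ j)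
        + (\<Sum>j<n. LINT t|?M. ?m i j t * w t $ j)"
      using c by (simp add: sum.distrib)
    also have "\<dots> = (vec_integral k a b (\<lambda>x. F x *\<^sub>v (c0 + (x - a) \<cdot>\<^sub>v c1))
         + vec_integral k a b (\<lambda>t. moment_mat k n b F t *\<^sub>v w t)) $ i"
      using i mv integrable_vec_L2_mult(2)[OF F A i] by simp
    finally show "vec_integral k a b (\<lambda>x. F x *\<^sub>v primitive2_vec a n c0 c1 w x) $ i
        = (vec_integral k a b (\<lambda>x. F x *\<^sub>v (c0 + (x - a) \<cdot>\<^sub>v c1))
         + vec_integral k a b (\<lambda>t. moment_mat k n b F t *\<^sub>v w t)) $ i" .
  qed simp
qed

section \<open>The boundary conditions in terms of \<open>G\<close> and \<open>H\<close>\<close>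

lemma AE_lebesgue_on_singleton:
  fixes a :: real shows "AE x in lebesgue_on {a..a}. P x"
  using AE_lebesgue_on_neq[of a a a] AE_space by eventually_elim auto

lemma primitive_vec_left:
  assumes "c \<in> carrier_vec n" shows "primitive_vec a n c w a = c"
  using assms integral_eq_zero_AE[OF AE_lebesgue_on_singleton]
  by (intro eq_vecI) (auto simp: primitive_vec_def primitive_def)

lemma primitive2_vec_left:
  assumes "c0 \<in> carrier_vec n" shows "primitive2_vec a n c0 c1 w a = c0"
  using assms integral_eq_zero_AE[OF AE_lebesgue_on_singleton]
  by (intro eq_vecI) (auto simp: primitive2_vec_def primitive2_def)

lemma integrable_vec_L2: "w \<in> L2_vec a b n \<Longrightarrow> integrable_vec a b n w"
  using L2_vec_carrier integrable_L2[OF L2_vec_component] by (auto simp: integrable_vec_def)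

lemma integrable_vec_smult_L2:
  assumes w: "w \<in> L2_vec a b n" and p: "continuous_on {a..b} p"
  shows "integrable_vec a b n (\<lambda>x. p x \<cdot>\<^sub>v w x)"
proof -
  have "integrable (lebesgue_on {a..b}) (\<lambda>x. (p x \<cdot>\<^sub>v w x) $ i)" if i: "i < n" for i
  proof -
    have "(p x \<cdot>\<^sub>v w x) $ i = w x $ i * p x" if "x \<in> {a..b}" for x
      using L2_vec_carrier[OF w that] i by simp
    moreover have "integrable (lebesgue_on {a..b}) (\<lambda>x. w x $ i * p x)"
      by (rule integrable_mult_continuous[OF integrable_L2[OF L2_vec_component[OF w i]] p])
    ultimately show ?thesis
      by (subst Bochner_Integration.integrable_cong[OF refl, where g = "\<lambda>x. w x $ i * p x"]) simp_all
  qed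
  then show ?thesis using L2_vec_carrier[OF w] by (simp add: integrable_vec_def)
qed

lemma primitive_vec_eq:
  assumes "w \<in> L2_vec a b n" "c \<in> carrier_vec n"
  shows "primitive_vec a n c w b = c + vec_integral n a b w"
  using assms by (intro eq_vecI) (auto simp: primitive_vec_def primitive_def vec_integral_def)

lemma primitive2_vec_eq:
  assumes w: "w \<in> L2_vec a b n" and "c0 \<in> carrier_vec n" "c1 \<in> carrier_vec n" and x: "x \<in> {a..b}"
  shows "primitive2_vec a n c0 c1 w x
       = c0 + (x - a) \<cdot>\<^sub>v c1 + vec_integral n a x (\<lambda>t. (x - t) \<cdot>\<^sub>v w t)"
proof (rule eq_vecI)
  fix i assume "i < dim_vec (c0 + (x - a) \<cdot>\<^sub>v c1 + vec_integral n a x (\<lambda>t. (x - t) \<cdot>\<^sub>v w t))"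
  then have i: "i < n" by simp
  have "(LINT t|lebesgue_on {a..x}. (x - t) * w t $ i) = (LINT t|lebesgue_on {a..x}. ((x - t) \<cdot>\<^sub>v w t) $ i)"
  proof (rule Bochner_Integration.integral_cong[OF refl])
    fix t assume "t \<in> space (lebesgue_on {a..x})"
    then have "w t \<in> carrier_vec n" using x by (intro L2_vec_carrier[OF w]) auto
    then show "(x - t) * w t $ i = ((x - t) \<cdot>\<^sub>v w t) $ i" using i by simp
  qed
  then show "primitive2_vec a n c0 c1 w x $ i
      = (c0 + (x - a) \<cdot>\<^sub>v c1 + vec_integral n a x (\<lambda>t. (x - t) \<cdot>\<^sub>v w t)) $ i"
    using i assms by (simp add: primitive2_vec_def primitive2_def vec_integral_def)
qed (simp add: primitive2_vec_def)

text \<open>The block column that E multiplies in \<open>H_mat\<close>. Its rows are the Taylor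
  remainder kernels of the four boundary data: 0 for the value and slope at a, b - x for the value
  at b, 1 for the slope at b.\<close>

definition boundary_kernel :: "real \<Rightarrow> nat \<Rightarrow> real \<Rightarrow> real mat" where
  "boundary_kernel b n x = 0\<^sub>m n n @\<^sub>r ((b - x) \<cdot>\<^sub>m 1\<^sub>m n) @\<^sub>r 0\<^sub>m n n @\<^sub>r 1\<^sub>m n"

text \<open>The block matrix that E multiplies in \<open>G_mat\<close>: the boundary data of the
  affine function with value c0 and slope c1 at a.\<close>

definition boundary_affine :: "real \<Rightarrow> real \<Rightarrow> nat \<Rightarrow> real mat" where
  "boundary_affine a b n = (1\<^sub>m n @\<^sub>c 0\<^sub>m n n) @\<^sub>r (1\<^sub>m n @\<^sub>c ((b - a) \<cdot>\<^sub>m 1\<^sub>m n)) @\<^sub>r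
     (0\<^sub>m n n @\<^sub>c 1\<^sub>m n) @\<^sub>r (0\<^sub>m n n @\<^sub>c 1\<^sub>m n)"

lemma boundary_kernel_carrier: "boundary_kernel b n x \<in> carrier_mat (4 * n) n"
proof -
  have "boundary_kernel b n x \<in> carrier_mat (n + (n + (n + n))) n"
    unfolding boundary_kernel_def by (intro carrier_append_rows) auto
  moreover have "n + (n + (n + n)) = 4 * n" by simp
  ultimately show ?thesis by metis
qed

lemma boundary_affine_carrier: "boundary_affine a b n \<in> carrier_mat (4 * n) (2 * n)"
proof -
  have "boundary_affine a b n \<in> carrier_mat (n + (n + (n + n))) (n + n)"
    unfolding boundary_affine_def by (intro carrier_append_rows append_cols_carrier) auto
  moreover have "n + (n + (n + n)) = 4 * n" "n + n = 2 * n" by simp_all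
  ultimately show ?thesis by metis
qed

lemma zero_mult_vec: "(v :: real vec) \<in> carrier_vec n \<Longrightarrow> 0\<^sub>m k n *\<^sub>v v = 0\<^sub>v k"
  by (intro eq_vecI) (auto simp: index_mult_mat_vec_sum[of _ k n] simp del: index_mult_mat_vec)

lemma boundary_kernel_mult:
  assumes v: "v \<in> carrier_vec n"
  shows "boundary_kernel b n x *\<^sub>v v = 0\<^sub>v n @\<^sub>v (b - x) \<cdot>\<^sub>v v @\<^sub>v 0\<^sub>v n @\<^sub>v v"
proof -
  have 1: "(0\<^sub>m n n @\<^sub>r 1\<^sub>m n) *\<^sub>v v = 0\<^sub>v n @\<^sub>v v"
    using mat_mult_append[of "0\<^sub>m n n" n n "1\<^sub>m n" n v] v by (simp add: zero_mult_vec)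
  have c1: "0\<^sub>m n n @\<^sub>r 1\<^sub>m n \<in> carrier_mat (n + n) n" by auto
  have 2: "(((b - x) \<cdot>\<^sub>m 1\<^sub>m n) @\<^sub>r 0\<^sub>m n n @\<^sub>r 1\<^sub>m n) *\<^sub>v v = (b - x) \<cdot>\<^sub>v v @\<^sub>v 0\<^sub>v n @\<^sub>v v"
    using mat_mult_append[OF _ c1 v, of "(b - x) \<cdot>\<^sub>m 1\<^sub>m n" n] v by (simp add: smult_one_mult_vec 1)
  have c2: "((b - x) \<cdot>\<^sub>m 1\<^sub>m n) @\<^sub>r 0\<^sub>m n n @\<^sub>r 1\<^sub>m n \<in> carrier_mat (n + (n + n)) n"
    by (intro carrier_append_rows) auto
  show ?thesis
    unfolding boundary_kernel_def
    using mat_mult_append[OF _ c2 v, of "0\<^sub>m n n" n] v by (simp add: zero_mult_vec 2)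
qed

lemma boundary_affine_mult:
  assumes c: "c0 \<in> carrier_vec n" "c1 \<in> carrier_vec n"
  shows "boundary_affine a b n *\<^sub>v (c0 @\<^sub>v c1) = c0 @\<^sub>v (c0 + (b - a) \<cdot>\<^sub>v c1) @\<^sub>v c1 @\<^sub>v c1"
proof -
  let ?A = "1\<^sub>m n @\<^sub>c 0\<^sub>m n n :: real mat" and ?B = "1\<^sub>m n @\<^sub>c ((b - a) \<cdot>\<^sub>m 1\<^sub>m n)"
  let ?C = "0\<^sub>m n n @\<^sub>c 1\<^sub>m n :: real mat"
  have v: "c0 @\<^sub>v c1 \<in> carrier_vec (n + n)" using c by auto
  have cA: "?A \<in> carrier_mat n (n + n)" and cB: "?B \<in> carrier_mat n (n + n)"
    and cC: "?C \<in> carrier_mat n (n + n)" by (intro append_cols_carrier; simp)+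
  have A: "?A *\<^sub>v (c0 @\<^sub>v c1) = c0"
    by (subst append_cols_mult[of _ n n _ n]) (use c in \<open>auto simp: zero_mult_vec\<close>)
  have B: "?B *\<^sub>v (c0 @\<^sub>v c1) = c0 + (b - a) \<cdot>\<^sub>v c1"
    by (subst append_cols_mult[of _ n n _ n]) (use c in \<open>auto simp: smult_one_mult_vec\<close>)
  have C: "?C *\<^sub>v (c0 @\<^sub>v c1) = c1"
    by (subst append_cols_mult[of _ n n _ n]) (use c in \<open>auto simp: zero_mult_vec\<close>)
  note c1 = carrier_append_rows[OF cC cC]
  note c2 = carrier_append_rows[OF cB c1]
  show ?thesis
    unfolding boundary_affine_def mat_mult_append[OF cA c2 v] mat_mult_append[OF cB c1 v]
      mat_mult_append[OF cC cC v] A B C ..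
qed

text \<open>Evaluating Taylor's formula and its derivative at a and b separates the affine part from
  the remainder, block by block.\<close>

lemma primitive2_values_eq:
  assumes "a < b" and w: "w \<in> L2_vec a b n" and c: "c0 \<in> carrier_vec n" "c1 \<in> carrier_vec n"
  shows "primitive2_values a b n c0 c1 w
       = boundary_affine a b n *\<^sub>v (c0 @\<^sub>v c1)
         + vec_integral (4 * n) a b (\<lambda>x. boundary_kernel b n x *\<^sub>v w x)" (is "_ = _ + ?I")
    and "integrable_vec a b (4 * n) (\<lambda>x. boundary_kernel b n x *\<^sub>v w x)"
proof -
  have w0: "integrable_vec a b n (\<lambda>x. 0\<^sub>v n)" by (simp add: integrable_vec_def)
  have w1: "integrable_vec a b n (\<lambda>x. (b - x) \<cdot>\<^sub>v w x)"
    by (intro integrable_vec_smult_L2[OF w] continuous_intros)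
  note ww = integrable_vec_L2[OF w]
  note 1 = vec_integral_append[OF w0 ww]
  note 2 = vec_integral_append[OF w1 1(2)]
  note 3 = vec_integral_append[OF w0 2(2)]
  have four: "n + (n + (n + n)) = 4 * n" by simp
  have e: "0\<^sub>v n @\<^sub>v (b - x) \<cdot>\<^sub>v w x @\<^sub>v 0\<^sub>v n @\<^sub>v w x = boundary_kernel b n x *\<^sub>v w x"
    if "x \<in> {a..b}" for x
    by (rule boundary_kernel_mult[OF L2_vec_carrier[OF w that], symmetric])
  show "integrable_vec a b (4 * n) (\<lambda>x. boundary_kernel b n x *\<^sub>v w x)"
    using integrable_vec_cong[OF 3(2) e] unfolding four .
  have z: "vec_integral n a b (\<lambda>x. 0\<^sub>v n) = 0\<^sub>v n"
    by (rule eq_vecI) (auto simp: vec_integral_def)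
  have I: "?I = 0\<^sub>v n @\<^sub>v vec_integral n a b (\<lambda>x. (b - x) \<cdot>\<^sub>v w x) @\<^sub>v 0\<^sub>v n @\<^sub>v vec_integral n a b w"
    using 3(1) vec_integral_cong[where k = "4 * n", OF e] unfolding 1(1) 2(1) z four by simp
  have b: "b \<in> {a..b}" using assms(1) by simp
  let ?p = "vec_integral n a b (\<lambda>x. (b - x) \<cdot>\<^sub>v w x)" and ?q = "vec_integral n a b w"
  have add: "(x1 @\<^sub>v x2 @\<^sub>v x3 @\<^sub>v x4) + (y1 @\<^sub>v y2 @\<^sub>v y3 @\<^sub>v y4)
      = (x1 + y1) @\<^sub>v (x2 + y2) @\<^sub>v (x3 + y3) @\<^sub>v (x4 + y4)"
    if "x1 \<in> carrier_vec n" "x2 \<in> carrier_vec n" "x3 \<in> carrier_vec n" "x4 \<in> carrier_vec n"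
      "y1 \<in> carrier_vec n" "y2 \<in> carrier_vec n" "y3 \<in> carrier_vec n" "y4 \<in> carrier_vec n"
    for x1 x2 x3 x4 y1 y2 y3 y4 :: "real vec"
  proof -
    have "(x3 @\<^sub>v x4) + (y3 @\<^sub>v y4) = (x3 + y3) @\<^sub>v (x4 + y4)"
      by (rule append_vec_add) (use that in auto)
    moreover have "(x2 @\<^sub>v x3 @\<^sub>v x4) + (y2 @\<^sub>v y3 @\<^sub>v y4) = (x2 + y2) @\<^sub>v ((x3 @\<^sub>v x4) + (y3 @\<^sub>v y4))"
      by (rule append_vec_add[of _ n _ _ "n + n"]) (use that in auto)
    moreover have "(x1 @\<^sub>v x2 @\<^sub>v x3 @\<^sub>v x4) + (y1 @\<^sub>v y2 @\<^sub>v y3 @\<^sub>v y4)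
        = (x1 + y1) @\<^sub>v ((x2 @\<^sub>v x3 @\<^sub>v x4) + (y2 @\<^sub>v y3 @\<^sub>v y4))"
      by (rule append_vec_add[of _ n _ _ "n + (n + n)"]) (use that in auto)
    ultimately show ?thesis by simp
  qed
  show "primitive2_values a b n c0 c1 w = boundary_affine a b n *\<^sub>v (c0 @\<^sub>v c1) + ?I"
    unfolding primitive2_values_def I boundary_affine_mult[OF c]
      primitive2_vec_left[OF c(1)] primitive_vec_left[OF c(2)]
      primitive2_vec_eq[OF w c b] primitive_vec_eq[OF w c(2)]
    by (subst add) (use c in auto)
qed

lemma G_mat_mult:
  assumes E: "E \<in> carrier_mat k (4 * n)" and F: "F \<in> L2_mat a b k n"
    and c: "c0 \<in> carrier_vec n" "c1 \<in> carrier_vec n"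
  shows "G_mat a b n E F *\<^sub>v (c0 @\<^sub>v c1)
       = E *\<^sub>v (boundary_affine a b n *\<^sub>v (c0 @\<^sub>v c1))
         + vec_integral k a b (\<lambda>x. F x *\<^sub>v (c0 + (x - a) \<cdot>\<^sub>v c1))"
proof -
  have v: "c0 @\<^sub>v c1 \<in> carrier_vec (2 * n)" unfolding mult_2 using c by (rule append_carrier_vec)
  have FA: "F x * affine_row a n x \<in> carrier_mat k (2 * n)" if "x \<in> {a..b}" for x
    using L2_mat_carrier[OF F that] affine_row_carrier by (rule mult_carrier_mat)
  have ar: "affine_row a n x $$ (j, l)
      = (if l < n then (if j = l then 1 else 0) else if j = l - n then x - a else 0)"
    if "j < n" "l < 2 * n" for x j l
    using that unfolding affine_row_def append_cols_def by (subst index_mat_four_block) auto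
  \<comment> \<open>Continuity of these entries makes each product with an integrable entry of F
    integrable, as needed to move the vector inside the matrix integral.\<close>
  have arc: "continuous_on {a..b} (\<lambda>x. affine_row a n x $$ (j, l))" if "j < n" "l < 2 * n" for j l
    unfolding ar[OF that]
    by (cases "l < n"; cases "j = l"; cases "j = l - n") (auto intro!: continuous_intros)
  have int: "integrable (lebesgue_on {a..b}) (\<lambda>x. (F x * affine_row a n x) $$ (i, l))"
    if "i < k" "l < 2 * n" for i l
  proof -
    have "(F x * affine_row a n x) $$ (i, l) = (\<Sum>j<n. F x $$ (i, j) * affine_row a n x $$ (j, l))"
      if "x \<in> {a..b}" for x
      using L2_mat_carrier[OF F that] affine_row_carrier[of a n x] \<open>i < k\<close> \<open>l < 2 * n\<close>
      by (simp add: scalar_prod_def atLeast0LessThan)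
    moreover have "integrable (lebesgue_on {a..b})
        (\<lambda>x. \<Sum>j<n. F x $$ (i, j) * affine_row a n x $$ (j, l))"
      using that by (intro Bochner_Integration.integrable_sum integrable_mult_continuous
          integrable_L2[OF L2_mat_entry[OF F]] arc) auto
    ultimately show ?thesis
      by (subst Bochner_Integration.integrable_cong[OF refl,
            where g = "\<lambda>x. \<Sum>j<n. F x $$ (i, j) * affine_row a n x $$ (j, l)"]) simp_all
  qed
  have M: "mat_integral k (2 * n) a b (\<lambda>x. F x * affine_row a n x) \<in> carrier_mat k (2 * n)"
    by (simp add: mat_integral_def)
  have EA: "E * boundary_affine a b n \<in> carrier_mat k (2 * n)"
    using E boundary_affine_carrier by (rule mult_carrier_mat)
  have "G_mat a b n E F = E * boundary_affine a b n
      + mat_integral k (2 * n) a b (\<lambda>x. F x * affine_row a n x)"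
    using E by (simp add: G_mat_def boundary_affine_def)
  then have "G_mat a b n E F *\<^sub>v (c0 @\<^sub>v c1) = (E * boundary_affine a b n) *\<^sub>v (c0 @\<^sub>v c1)
      + mat_integral k (2 * n) a b (\<lambda>x. F x * affine_row a n x) *\<^sub>v (c0 @\<^sub>v c1)"
    by (simp add: add_mult_distrib_mat_vec[OF EA M v])
  also have "(E * boundary_affine a b n) *\<^sub>v (c0 @\<^sub>v c1) = E *\<^sub>v (boundary_affine a b n *\<^sub>v (c0 @\<^sub>v c1))"
    by (rule assoc_mult_mat_vec[OF E boundary_affine_carrier v])
  also have "mat_integral k (2 * n) a b (\<lambda>x. F x * affine_row a n x) *\<^sub>v (c0 @\<^sub>v c1)
      = vec_integral k a b (\<lambda>x. (F x * affine_row a n x) *\<^sub>v (c0 @\<^sub>v c1))"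
    by (rule mat_integral_mult_vec(1)[OF FA int v])
  also have "\<dots> = vec_integral k a b (\<lambda>x. F x *\<^sub>v (c0 + (x - a) \<cdot>\<^sub>v c1))"
    by (rule vec_integral_cong)
       (simp add: assoc_mult_mat_vec[OF L2_mat_carrier[OF F] affine_row_carrier v] affine_row_mult[OF c])
  finally show ?thesis .
qed

lemma H_mat_carrier:
  assumes E: "E \<in> carrier_mat k (4 * n)" shows "H_mat b n E F x \<in> carrier_mat k n"
proof -
  have "H_mat b n E F x = - (E * boundary_kernel b n x) - moment_mat k n b F x"
    using E by (simp add: H_mat_def boundary_kernel_def moment_mat_def)
  then show ?thesis using moment_mat_carrier by (simp only: minus_carrier_mat)
qed

lemma H_mat_mult:
  assumes E: "E \<in> carrier_mat k (4 * n)" and v: "v \<in> carrier_vec n"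
  shows "H_mat b n E F x *\<^sub>v v
       = - (E *\<^sub>v (boundary_kernel b n x *\<^sub>v v) + moment_mat k n b F x *\<^sub>v v)"
proof -
  have EB: "E * boundary_kernel b n x \<in> carrier_mat k n"
    by (rule mult_carrier_mat[OF E boundary_kernel_carrier])
  have "H_mat b n E F x = - (E * boundary_kernel b n x) - moment_mat k n b F x"
    using E by (simp add: H_mat_def boundary_kernel_def moment_mat_def)
  then have "H_mat b n E F x *\<^sub>v v = - (E * boundary_kernel b n x) *\<^sub>v v - moment_mat k n b F x *\<^sub>v v"
    using EB v by (simp add: minus_mult_distrib_mat_vec[of _ k n])
  also have "- (E * boundary_kernel b n x) *\<^sub>v v = - (E *\<^sub>v (boundary_kernel b n x *\<^sub>v v))"
  proof -
    have "dim_vec v = dim_col (E * boundary_kernel b n x)" using EB v by auto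
    then show ?thesis by (simp only: uminus_mult_mat_vec assoc_mult_mat_vec[OF E boundary_kernel_carrier v])
  qed
  finally show ?thesis
    using E v by (intro eq_vecI) (auto simp: moment_mat_def mat_integral_def)
qed

text \<open>Negation is multiplication by the constant matrix -I, so linearity for constant matrices
  applies.\<close>

lemma vec_integral_uminus:
  assumes f: "integrable_vec a b k f"
  shows "vec_integral k a b (\<lambda>x. - f x) = - vec_integral k a b f"
    and "integrable_vec a b k (\<lambda>x. - f x)"
proof -
  have M: "(- 1\<^sub>m k :: real mat) \<in> carrier_mat k k" by simp
  have u: "(- 1\<^sub>m k) *\<^sub>v v = - v" if "v \<in> carrier_vec k" for v :: "real vec"
    using that by simp
  have e: "(- 1\<^sub>m k) *\<^sub>v f x = - f x" if "x \<in> {a..b}" for x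
    using f that by (intro u) (simp add: integrable_vec_def)
  show "integrable_vec a b k (\<lambda>x. - f x)"
    by (rule integrable_vec_cong[OF vec_integral_mult_const(2)[OF M f] e])
  show "vec_integral k a b (\<lambda>x. - f x) = - vec_integral k a b f"
    using vec_integral_mult_const(1)[OF M f] vec_integral_cong[where k = k, OF e] u[of "vec_integral k a b f"]
    by simp
qed

text \<open>
  The left-hand side of the constraint that defines \<open>X\<close>, with the boundary values as a separate argument \<open>z\<close>.
\<close>

definition residual :: "real \<Rightarrow> real \<Rightarrow> nat \<Rightarrow> real mat \<Rightarrow> (real \<Rightarrow> real mat) \<Rightarrow> real vec \<Rightarrow>
    (real \<Rightarrow> real vec) \<Rightarrow> real vec" where
  "residual a b k E F z u = E *\<^sub>v z + vec_integral k a b (\<lambda>x. F x *\<^sub>v u x)"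

text \<open>The c-dependent parts of the boundary values and of the integral assemble to G. The
  w-dependent parts, the boundary kernel multiplied by E and the moment term from Fubini, assemble
  to -H, whence the minus sign.\<close>

lemma residual_primitive2:
  assumes "a < b" and E: "E \<in> carrier_mat k (4 * n)" and F: "F \<in> L2_mat a b k n"
    and w: "w \<in> L2_vec a b n" and c: "c0 \<in> carrier_vec n" "c1 \<in> carrier_vec n"
  shows "residual a b k E F (primitive2_values a b n c0 c1 w) (primitive2_vec a n c0 c1 w)
       = G_mat a b n E F *\<^sub>v (c0 @\<^sub>v c1) - vec_integral k a b (\<lambda>x. H_mat b n E F x *\<^sub>v w x)"
    and "integrable_vec a b k (\<lambda>x. H_mat b n E F x *\<^sub>v w x)"
proof -
  note Q = primitive2_values_eq[OF assms(1) w c]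
  note EQ = vec_integral_mult_const[OF E Q(2)]
  note P = integral_mult_primitive2_vec[OF F w c]
  note S = vec_integral_add[OF EQ(2) P(2)]
  note U = vec_integral_uminus[OF S(2)]
  have h: "- (E *\<^sub>v (boundary_kernel b n x *\<^sub>v w x) + moment_mat k n b F x *\<^sub>v w x)
      = H_mat b n E F x *\<^sub>v w x" if "x \<in> {a..b}" for x
    by (rule H_mat_mult[OF E L2_vec_carrier[OF w that], symmetric])
  show "integrable_vec a b k (\<lambda>x. H_mat b n E F x *\<^sub>v w x)"
    by (rule integrable_vec_cong[OF U(2) h])
  have H: "vec_integral k a b (\<lambda>x. H_mat b n E F x *\<^sub>v w x)
      = - (E *\<^sub>v vec_integral (4 * n) a b (\<lambda>x. boundary_kernel b n x *\<^sub>v w x)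
           + vec_integral k a b (\<lambda>x. moment_mat k n b F x *\<^sub>v w x))"
    using U(1) vec_integral_cong[where k = k, OF h] unfolding S(1) EQ(1) by simp
  have v: "boundary_affine a b n *\<^sub>v (c0 @\<^sub>v c1) \<in> carrier_vec (4 * n)"
    by (rule mult_mat_vec_carrier[OF boundary_affine_carrier])
       (unfold mult_2, rule append_carrier_vec[OF c])
  have d: "dim_row E = k" using E by simp
  show "residual a b k E F (primitive2_values a b n c0 c1 w) (primitive2_vec a n c0 c1 w)
       = G_mat a b n E F *\<^sub>v (c0 @\<^sub>v c1) - vec_integral k a b (\<lambda>x. H_mat b n E F x *\<^sub>v w x)"
    unfolding residual_def Q(1) P(1) G_mat_mult[OF E F c] H mult_add_distrib_mat_vec[OF E v vec_integral_carrier]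
    by (rule eq_vecI) (simp_all add: d del: index_mult_mat_vec)
qed

section \<open>Stacking constraints and multiplying them by a matrix\<close>

lemma append_rows_in_L2_mat:
  assumes "F1 \<in> L2_mat a b k n" "F2 \<in> L2_mat a b l n"
  shows "(\<lambda>x. F1 x @\<^sub>r F2 x) \<in> L2_mat a b (k + l) n"
proof -
  have ix: "(F1 x @\<^sub>r F2 x) $$ (i, j) = (if i < k then F1 x $$ (i, j) else F2 x $$ (i - k, j))"
    if "x \<in> {a..b}" "i < k + l" "j < n" for x i j
    using L2_mat_carrier[OF assms(1) that(1)] L2_mat_carrier[OF assms(2) that(1)] that(2,3)
    unfolding append_rows_def by (subst index_mat_four_block) auto
  have "(\<lambda>x. (F1 x @\<^sub>r F2 x) $$ (i, j)) \<in> L2 a b" if "i < k + l" "j < n" for i j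
  proof (rule L2_cong_AE)
    show "(\<lambda>x. if i < k then F1 x $$ (i, j) else F2 x $$ (i - k, j)) \<in> L2 a b"
      using that L2_mat_entry[OF assms(1), of i j] L2_mat_entry[OF assms(2), of "i - k" j]
      by (cases "i < k") auto
    show "AE x in lebesgue_on {a..b}. (if i < k then F1 x $$ (i, j) else F2 x $$ (i - k, j))
        = (F1 x @\<^sub>r F2 x) $$ (i, j)"
      by (rule AE_I2) (use ix that in simp)
  qed
  then show ?thesis
    using carrier_append_rows[OF L2_mat_carrier[OF assms(1)] L2_mat_carrier[OF assms(2)]]
    by (simp add: L2_mat_def)
qed

text \<open>Needed for two lower blocks: (E2, F2) in the transformed constraint of X, and (0, F3) in
  the augmented pair.\<close>

lemma residual_append:
  assumes E: "E1 \<in> carrier_mat k p" "E2 \<in> carrier_mat l p"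
    and F: "F1 \<in> L2_mat a b k n" "F2 \<in> L2_mat a b l n"
    and z: "z \<in> carrier_vec p" and u: "u \<in> L2_vec a b n"
  shows "residual a b (k + l) (E1 @\<^sub>r E2) (\<lambda>x. F1 x @\<^sub>r F2 x) z u
       = residual a b k E1 F1 z u @\<^sub>v residual a b l E2 F2 z u"
proof -
  have e: "(F1 x @\<^sub>r F2 x) *\<^sub>v u x = (F1 x *\<^sub>v u x) @\<^sub>v (F2 x *\<^sub>v u x)" if "x \<in> {a..b}" for x
    by (rule mat_mult_append[OF L2_mat_carrier[OF F(1) that] L2_mat_carrier[OF F(2) that]
          L2_vec_carrier[OF u that]])
  have "vec_integral (k + l) a b (\<lambda>x. (F1 x @\<^sub>r F2 x) *\<^sub>v u x)
      = vec_integral k a b (\<lambda>x. F1 x *\<^sub>v u x) @\<^sub>v vec_integral l a b (\<lambda>x. F2 x *\<^sub>v u x)"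
    unfolding vec_integral_append(1)[OF integrable_vec_L2_mult(1)[OF F(1) u]
        integrable_vec_L2_mult(1)[OF F(2) u], symmetric]
    by (rule vec_integral_cong[OF e])
  then show ?thesis
    unfolding residual_def mat_mult_append[OF E z]
    using E z by (simp add: append_vec_add[of _ k _ _ l] mult_mat_vec_carrier[of _ k p] mult_mat_vec_carrier[of _ l p])
qed

text \<open>J is constant and passes under the integral; the factorisation of J F is known only
  almost everywhere, which the integral does not see.\<close>

lemma mult_residual:
  assumes J: "J \<in> carrier_mat k k" and E: "E \<in> carrier_mat k p" and F: "F \<in> L2_mat a b k n"
    and z: "z \<in> carrier_vec p" and u: "u \<in> L2_vec a b n"
    and JE: "J * E = E'" and JF: "AE x in lebesgue_on {a..b}. J * F x = F' x"
  shows "J *\<^sub>v residual a b k E F z u = residual a b k E' F' z u"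
proof -
  note i = integrable_vec_L2_mult(1)[OF F u]
  note JI = vec_integral_mult_const[OF J i]
  have "vec_integral k a b (\<lambda>x. J *\<^sub>v (F x *\<^sub>v u x)) = vec_integral k a b (\<lambda>x. F' x *\<^sub>v u x)"
  proof (rule vec_integral_cong_AE[OF JI(2)])
    show "AE x in lebesgue_on {a..b}. J *\<^sub>v (F x *\<^sub>v u x) = F' x *\<^sub>v u x"
      using JF AE_space
    proof eventually_elim
      case (elim x)
      then have "x \<in> {a..b}" by simp
      from assoc_mult_mat_vec[OF J L2_mat_carrier[OF F this] L2_vec_carrier[OF u this]]
      show ?case using elim(1) by simp
    qed
  qed
  then show ?thesis
    unfolding residual_def mult_add_distrib_mat_vec[OF J mult_mat_vec_carrier[OF E z] vec_integral_carrier]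
      JI(1)[symmetric] JE[symmetric] assoc_mult_mat_vec[OF J E z] by simp
qed

lemma vec_integral_mult_cong_AE:
  assumes F: "F \<in> L2_mat a b k n" and u: "u \<in> L2_vec a b n"
    and "AE x in lebesgue_on {a..b}. u x = u' x"
  shows "vec_integral k a b (\<lambda>x. F x *\<^sub>v u x) = vec_integral k a b (\<lambda>x. F x *\<^sub>v u' x)"
  by (rule vec_integral_cong_AE[OF integrable_vec_L2_mult(1)[OF F u]])
     (use assms(3) in eventually_elim, simp)

section \<open>Inverse matrices and the reconstruction formula\<close>

lemma invertible_mat_mult_eq_0:
  assumes J: "J \<in> carrier_mat k k" and "invertible_mat J" and v: "v \<in> carrier_vec k"
    and z: "J *\<^sub>v v = 0\<^sub>v k"
  shows "(v :: real vec) = 0\<^sub>v k"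
proof -
  obtain B where B: "B * J = 1\<^sub>m (dim_row B)" "J * B = 1\<^sub>m (dim_row J)"
    using assms(2) unfolding invertible_mat_def inverts_mat_def by blast
  \<comment> \<open>Invertibility supplies only the two products; comparing their column counts with
    those of the identity matrices recovers the dimensions of B.\<close>
  have "dim_col (B * J) = dim_row B" "dim_col (J * B) = dim_row J" unfolding B by simp_all
  then have Bc: "B \<in> carrier_mat k k" using J by auto
  have "v = (B * J) *\<^sub>v v" using B(1) Bc v by simp
  also have "\<dots> = B *\<^sub>v 0\<^sub>v k" using assoc_mult_mat_vec[OF Bc J v] z by simp
  also have "\<dots> = 0\<^sub>v k"
    using Bc by (intro eq_vecI) (auto simp: index_mult_mat_vec_sum[OF Bc] simp del: index_mult_mat_vec)
  finally show ?thesis .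
qed

lemma mat_inv:
  assumes A: "A \<in> carrier_mat k k" and "invertible_mat A"
  shows "mat_inv A \<in> carrier_mat k k" "A * mat_inv A = 1\<^sub>m k" "mat_inv A * A = 1\<^sub>m k"
proof -
  obtain B where B: "B * A = 1\<^sub>m (dim_row B)" "A * B = 1\<^sub>m (dim_row A)"
    using assms(2) unfolding invertible_mat_def inverts_mat_def by blast
  have "dim_col (B * A) = dim_row B" "dim_col (A * B) = dim_row A" unfolding B by simp_all
  then have Bc: "B \<in> carrier_mat k k" using A by auto
  \<comment> \<open>\<open>mat_inverse\<close> fails only outside the units of the matrix ring, so
    membership there guarantees a result.\<close>
  then have "A \<in> Units (ring_mat TYPE(real) k ())"
    using A B by (auto simp: Units_def ring_mat_def)
  then obtain C where "mat_inverse A = Some C"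
    using mat_inverse(1)[OF A, of "()"] by (cases "mat_inverse A") auto
  then show "mat_inv A \<in> carrier_mat k k" "A * mat_inv A = 1\<^sub>m k" "mat_inv A * A = 1\<^sub>m k"
    using mat_inverse(2)[OF A] by (auto simp: mat_inv_def)
qed

text \<open>For fixed x, the affine row times the inverse of G is constant in t and leaves the
  integral. The terms with v0 and with H then add up to the affine row applied to (c0, c1), the
  affine part of Taylor's formula; the remaining integral of \<open>op_T1\<close> is its
  remainder.\<close>

lemma op_T_eq:
  assumes "a < b" and x: "x \<in> {a..b}" and G: "mat_inv G \<in> carrier_mat (2 * n) (2 * n)"
    and H: "\<And>t. t \<in> {a..b} \<Longrightarrow> H t \<in> carrier_mat (2 * n) n"
    and Hw: "integrable_vec a b (2 * n) (\<lambda>t. H t *\<^sub>v w t)"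
    and w: "w \<in> L2_vec a b n" and m: "m \<le> 2 * n" and v: "v0 \<in> carrier_vec m"
    and c: "c0 \<in> carrier_vec n" "c1 \<in> carrier_vec n"
    and eq: "c0 @\<^sub>v c1
      = mat_inv G *\<^sub>v ((0\<^sub>v (2 * n - m) @\<^sub>v v0) + vec_integral (2 * n) a b (\<lambda>t. H t *\<^sub>v w t))"
  shows "op_T a b n m G H (v0, w) x = primitive2_vec a n c0 c1 w x"
proof -
  let ?A = "affine_row a n x * mat_inv G"
  let ?R = "0\<^sub>m (2 * n - m) m @\<^sub>r 1\<^sub>m m :: real mat"
  let ?I = "vec_integral (2 * n) a b (\<lambda>t. H t *\<^sub>v w t)"
  have A: "?A \<in> carrier_mat n (2 * n)" by (rule mult_carrier_mat[OF affine_row_carrier G])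
  have R: "?R \<in> carrier_mat (2 * n) m"
    using carrier_append_rows[of "0\<^sub>m (2 * n - m) m" "2 * n - m" m "1\<^sub>m m" m] m by simp
  have Rv: "?R *\<^sub>v v0 = 0\<^sub>v (2 * n - m) @\<^sub>v v0"
    using mat_mult_append[of "0\<^sub>m (2 * n - m) m" "2 * n - m" m "1\<^sub>m m" m v0] v
    by (simp add: zero_mult_vec)
  have z: "0\<^sub>v (2 * n - m) @\<^sub>v v0 \<in> carrier_vec (2 * n)"
    unfolding Rv[symmetric] by (rule mult_mat_vec_carrier[OF R v])
  have "T1_kernel a n G H x t *\<^sub>v w t = ?A *\<^sub>v (H t *\<^sub>v w t)" if "t \<in> {a..b}" for t
    unfolding T1_kernel_def by (rule assoc_mult_mat_vec[OF A H[OF that] L2_vec_carrier[OF w that]])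
  then have "vec_integral n a b (\<lambda>t. T1_kernel a n G H x t *\<^sub>v w t)
      = vec_integral n a b (\<lambda>t. ?A *\<^sub>v (H t *\<^sub>v w t))"
    by (rule vec_integral_cong)
  also have "\<dots> = ?A *\<^sub>v ?I" by (rule vec_integral_mult_const(1)[OF A Hw])
  finally have T1: "vec_integral n a b (\<lambda>t. T1_kernel a n G H x t *\<^sub>v w t) = ?A *\<^sub>v ?I" .
  have T0: "op_T0 a n m G v0 x = ?A *\<^sub>v (0\<^sub>v (2 * n - m) @\<^sub>v v0)"
    unfolding op_T0_def T0_kernel_def assoc_mult_mat_vec[OF A R v] Rv ..
  have "?A *\<^sub>v (0\<^sub>v (2 * n - m) @\<^sub>v v0) + ?A *\<^sub>v ?I
      = ?A *\<^sub>v ((0\<^sub>v (2 * n - m) @\<^sub>v v0) + ?I)"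
    by (rule mult_add_distrib_mat_vec[OF A z vec_integral_carrier, symmetric])
  also have "\<dots> = affine_row a n x *\<^sub>v (c0 @\<^sub>v c1)"
    unfolding eq
    by (rule assoc_mult_mat_vec[OF affine_row_carrier G add_carrier_vec[OF z vec_integral_carrier]])
  also have "\<dots> = c0 + (x - a) \<cdot>\<^sub>v c1" by (rule affine_row_mult[OF c])
  finally have s: "?A *\<^sub>v (0\<^sub>v (2 * n - m) @\<^sub>v v0) + ?A *\<^sub>v ?I = c0 + (x - a) \<cdot>\<^sub>v c1" .
  have "op_T a b n m G H (v0, w) x
      = ?A *\<^sub>v (0\<^sub>v (2 * n - m) @\<^sub>v v0) + (?A *\<^sub>v ?I + vec_integral n a x (\<lambda>t. (x - t) \<cdot>\<^sub>v w t))"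
    by (simp add: op_T_def op_T1_def T0 T1)
  also have "\<dots> = (?A *\<^sub>v (0\<^sub>v (2 * n - m) @\<^sub>v v0) + ?A *\<^sub>v ?I) + vec_integral n a x (\<lambda>t. (x - t) \<cdot>\<^sub>v w t)"
    by (rule assoc_add_vec[OF mult_mat_vec_carrier[OF A z] mult_mat_vec_carrier[OF A vec_integral_carrier]
          vec_integral_carrier, symmetric])
  also have "\<dots> = primitive2_vec a n c0 c1 w x"
    unfolding s primitive2_vec_eq[OF w c x] ..
  finally show ?thesis .
qed

lemma primitive2_values_carrier: "primitive2_values a b n c0 c1 w \<in> carrier_vec (4 * n)"
proof -
  have "primitive2_values a b n c0 c1 w \<in> carrier_vec (n + (n + (n + n)))"
    unfolding primitive2_values_def by (intro append_carrier_vec) (auto simp: primitive_vec_def)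
  moreover have "n + (n + (n + n)) = 4 * n" by simp
  ultimately show ?thesis by metis
qed

lemma minus_vec_eq_imp_eq_add_vec:
  fixes x y z :: "real vec"
  assumes "x \<in> carrier_vec k" "y \<in> carrier_vec k" "x - y = z"
  shows "x = z + y"
  unfolding assms(3)[symmetric] using assms(1,2) by (intro eq_vecI) auto

lemma add_diff_cancel_right_vec:
  fixes x y :: "real vec"
  assumes "x \<in> carrier_vec k" "y \<in> carrier_vec k"
  shows "x + y - y = x"
  using assms by (intro eq_vecI) auto

section \<open>\<open>op_D\<close> and \<open>op_T\<close> are mutually inverse between X and
  Y\<close>

theorem theorem8:
  fixes a b :: real and n m :: nat
    and E J E1 E2 Ghat :: "real mat"
    and F F1 F2 F3 Hhat :: "real \<Rightarrow> real mat"
  assumes "a < b" and "n \<ge> 1" and "m \<le> 2 * n"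
    and "E \<in> carrier_mat (2 * n) (4 * n)"
    and "F \<in> L2_mat a b (2 * n) n"
    and "J \<in> carrier_mat (2 * n) (2 * n)" and "invertible_mat J"
    and "E1 \<in> carrier_mat (2 * n - m) (4 * n)" and "E2 \<in> carrier_mat m (4 * n)"
    and "J * E = E1 @\<^sub>r E2"
    and "F1 \<in> L2_mat a b (2 * n - m) n" and "F2 \<in> L2_mat a b m n"
    and "AE x in lebesgue_on {a..b}. J * F x = F1 x @\<^sub>r F2 x"
    and "vec_space.rank (2 * n - m) (G_mat a b n E1 F1) = 2 * n - m"
    and "G_mat a b n E2 F2 = 0\<^sub>m m (2 * n)"
    and "F3 \<in> L2_mat a b m n"
    and "Ghat = G_mat a b n (E1 @\<^sub>r 0\<^sub>m m (4 * n)) (\<lambda>x. F1 x @\<^sub>r F3 x)"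
    and "invertible_mat Ghat"
    and "Hhat = H_mat b n (E1 @\<^sub>r 0\<^sub>m m (4 * n)) (\<lambda>x. F1 x @\<^sub>r F3 x)"
  shows "(\<forall>u \<in> space_X a b n E F.
            op_D a b n m F3 u \<in> space_Y a b n m E2 F2 \<and>
            (AE x in lebesgue_on {a..b}. u x = op_T a b n m Ghat Hhat (op_D a b n m F3 u) x)) \<and>
         (\<forall>v \<in> space_Y a b n m E2 F2.
            op_T a b n m Ghat Hhat v \<in> space_X a b n E F \<and>
            fst v = fst (op_D a b n m F3 (op_T a b n m Ghat Hhat v)) \<and>
            (AE x in lebesgue_on {a..b}.
               snd v x = snd (op_D a b n m F3 (op_T a b n m Ghat Hhat v)) x))"
proof -
  let ?M = "lebesgue_on {a..b}"
  let ?k = "2 * n - m"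
  let ?E0 = "0\<^sub>m m (4 * n) :: real mat"
  let ?EE = "E1 @\<^sub>r ?E0" and ?FF = "\<lambda>x. F1 x @\<^sub>r F3 x"
  let ?val = "primitive2_values a b n" and ?pr = "primitive2_vec a n"
  \<comment> \<open>Subtraction of naturals is truncated, so m \<le> 2n is what lets the two row
    blocks fill exactly 2n rows.\<close>
  have km: "?k + m = 2 * n" using assms(3) by simp
  have EE: "?EE \<in> carrier_mat (2 * n) (4 * n)"
    using carrier_append_rows[OF assms(8) zero_carrier_mat[of m]] unfolding km .
  have FF: "?FF \<in> L2_mat a b (2 * n) n"
    using append_rows_in_L2_mat[OF assms(11,16)] unfolding km .
  have Gc: "Ghat \<in> carrier_mat (2 * n) (2 * n)"
    unfolding assms(17) using EE by (simp add: G_mat_def mat_integral_def)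
  note Gi = mat_inv[OF Gc assms(18)]
  have Hc: "Hhat t \<in> carrier_mat (2 * n) n" for t
    unfolding assms(19) by (rule H_mat_carrier[OF EE])
  \<comment> \<open>These facts hold for arbitrary c0, c1 and w. Both directions of the theorem read
    them, in opposite order: the first starts from a vanishing residual for (E, F), the second from
    the equation for (c0, c1).\<close>
  have res: "residual a b (2 * n) ?EE ?FF (?val c0 c1 w) (?pr c0 c1 w)
        = Ghat *\<^sub>v (c0 @\<^sub>v c1) - vec_integral (2 * n) a b (\<lambda>x. Hhat x *\<^sub>v w x)"
    "integrable_vec a b (2 * n) (\<lambda>x. Hhat x *\<^sub>v w x)"
    "residual a b (2 * n) ?EE ?FF (?val c0 c1 w) (?pr c0 c1 w)
        = residual a b ?k E1 F1 (?val c0 c1 w) (?pr c0 c1 w) @\<^sub>v vec_integral m a b (\<lambda>x. F3 x *\<^sub>v ?pr c0 c1 w x)"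
    "residual a b m E2 F2 (?val c0 c1 w) (?pr c0 c1 w) = - vec_integral m a b (\<lambda>x. H_mat b n E2 F2 x *\<^sub>v w x)"
    "J *\<^sub>v residual a b (2 * n) E F (?val c0 c1 w) (?pr c0 c1 w)
        = residual a b ?k E1 F1 (?val c0 c1 w) (?pr c0 c1 w) @\<^sub>v residual a b m E2 F2 (?val c0 c1 w) (?pr c0 c1 w)"
    if w: "w \<in> L2_vec a b n" and c: "c0 \<in> carrier_vec n" "c1 \<in> carrier_vec n" for w c0 c1
  proof -
    note z = primitive2_values_carrier[of a b n c0 c1 w]
    note u = L2_vec_primitive2_vec[OF w, of c0 c1]
    have cc: "c0 @\<^sub>v c1 \<in> carrier_vec (2 * n)"
      unfolding mult_2 using c by (rule append_carrier_vec)
    show "residual a b (2 * n) ?EE ?FF (?val c0 c1 w) (?pr c0 c1 w)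
        = Ghat *\<^sub>v (c0 @\<^sub>v c1) - vec_integral (2 * n) a b (\<lambda>x. Hhat x *\<^sub>v w x)"
      unfolding assms(17,19) by (rule residual_primitive2(1)[OF assms(1) EE FF w c])
    show "integrable_vec a b (2 * n) (\<lambda>x. Hhat x *\<^sub>v w x)"
      unfolding assms(19) by (rule residual_primitive2(2)[OF assms(1) EE FF w c])
    \<comment> \<open>The zero block removes the boundary term, leaving exactly the first component
      of \<open>op_D\<close>.\<close>
    have "residual a b m ?E0 F3 (?val c0 c1 w) (?pr c0 c1 w) = vec_integral m a b (\<lambda>x. F3 x *\<^sub>v ?pr c0 c1 w x)"
      unfolding residual_def zero_mult_vec[OF z] by (rule left_zero_vec[OF vec_integral_carrier])
    then show "residual a b (2 * n) ?EE ?FF (?val c0 c1 w) (?pr c0 c1 w)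
        = residual a b ?k E1 F1 (?val c0 c1 w) (?pr c0 c1 w) @\<^sub>v vec_integral m a b (\<lambda>x. F3 x *\<^sub>v ?pr c0 c1 w x)"
      using residual_append[OF assms(8) zero_carrier_mat assms(11,16) z u] unfolding km by simp
    show "residual a b m E2 F2 (?val c0 c1 w) (?pr c0 c1 w) = - vec_integral m a b (\<lambda>x. H_mat b n E2 F2 x *\<^sub>v w x)"
      unfolding residual_primitive2(1)[OF assms(1,9,12) w c] assms(15) zero_mult_vec[OF cc]
      by (rule eq_vecI) auto
    show "J *\<^sub>v residual a b (2 * n) E F (?val c0 c1 w) (?pr c0 c1 w)
        = residual a b ?k E1 F1 (?val c0 c1 w) (?pr c0 c1 w) @\<^sub>v residual a b m E2 F2 (?val c0 c1 w) (?pr c0 c1 w)"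
      unfolding mult_residual[OF assms(6,4,5) z u assms(10,13)]
      using residual_append[OF assms(8,9,11,12) z u] unfolding km .
  qed
  have rc: "residual a b k E F z u \<in> carrier_vec k" if "E \<in> carrier_mat k p" for k p E F z u
  proof -
    have "E *\<^sub>v z \<in> carrier_vec k" using that by (intro carrier_vecI) auto
    then show ?thesis by (simp add: residual_def)
  qed
  have zz: "0\<^sub>v (2 * n) = 0\<^sub>v ?k @\<^sub>v (0\<^sub>v m :: real vec)"
    by (rule eq_vecI) (use km in auto)
  have "op_D a b n m F3 u \<in> space_Y a b n m E2 F2 \<and>
      (AE x in ?M. u x = op_T a b n m Ghat Hhat (op_D a b n m F3 u) x)"
    if "u \<in> space_X a b n E F" for u
  proof -
    have uW: "u \<in> W2 a b n"
      and X: "E *\<^sub>v boundary_values a b n u + vec_integral (2 * n) a b (\<lambda>x. F x *\<^sub>v u x) = 0\<^sub>v (2 * n)"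
      using that assms(4) by (auto simp: space_X_def)
    have uL: "u \<in> L2_vec a b n" using uW by (simp add: W2_def)
    define w where "w = weak_deriv_vec a b n (weak_deriv_vec a b n u)"
    have w: "w \<in> L2_vec a b n" unfolding w_def by (rule W2_imp_primitive2_vec(1)[OF assms(1) uW])
    obtain c0 c1 where c: "c0 \<in> carrier_vec n" "c1 \<in> carrier_vec n"
      and ae: "AE x in ?M. u x = ?pr c0 c1 w x"
      using W2_imp_primitive2_vec(2)[OF assms(1) uW] unfolding w_def by blast
    note r = res[OF w c]
    have "residual a b (2 * n) E F (?val c0 c1 w) (?pr c0 c1 w) = 0\<^sub>v (2 * n)"
      using X unfolding residual_def AE_eq_primitive2_vec(1)[OF assms(1) w ae]
        vec_integral_mult_cong_AE[OF assms(5) uL ae] .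
    \<comment> \<open>Applying J to the vanishing residual and cutting after 2n - m rows separates
      the two groups of constraints.\<close>
    then have "residual a b ?k E1 F1 (?val c0 c1 w) (?pr c0 c1 w) @\<^sub>v residual a b m E2 F2 (?val c0 c1 w) (?pr c0 c1 w)
        = 0\<^sub>v ?k @\<^sub>v 0\<^sub>v m"
      unfolding r(5)[symmetric] zz[symmetric] using assms(6) 
      by (intro eq_vecI) (auto simp: scalar_prod_def)
    then have r1: "residual a b ?k E1 F1 (?val c0 c1 w) (?pr c0 c1 w) = 0\<^sub>v ?k"
      and r2: "residual a b m E2 F2 (?val c0 c1 w) (?pr c0 c1 w) = 0\<^sub>v m"
      using append_vec_eq[OF rc[OF assms(8)] zero_carrier_vec] by blast+
    have "vec_integral m a b (\<lambda>x. H_mat b n E2 F2 x *\<^sub>v w x) = 0\<^sub>v m"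
      using r(4) unfolding r2 by (metis uminus_uminus_vec uminus_zero_vec)
    then have Y: "op_D a b n m F3 u \<in> space_Y a b n m E2 F2"
      using w by (simp add: op_D_def space_Y_def w_def)
    let ?v0 = "vec_integral m a b (\<lambda>x. F3 x *\<^sub>v u x)"
    let ?I = "vec_integral (2 * n) a b (\<lambda>x. Hhat x *\<^sub>v w x)"
    have cc: "c0 @\<^sub>v c1 \<in> carrier_vec (2 * n)"
      unfolding mult_2 using c by (rule append_carrier_vec)
    \<comment> \<open>Two expressions for the augmented residual are equated; its upper rows vanish
      by \<open>r1\<close>. Inverting G then expresses (c0, c1) through \<open>op_D\<close> applied
      to u.\<close>
    have "Ghat *\<^sub>v (c0 @\<^sub>v c1) - ?I = 0\<^sub>v ?k @\<^sub>v ?v0"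
      using r(1,3) unfolding r1 vec_integral_mult_cong_AE[OF assms(16) uL ae] by simp
    then have "Ghat *\<^sub>v (c0 @\<^sub>v c1) = (0\<^sub>v ?k @\<^sub>v ?v0) + ?I"
      by (rule minus_vec_eq_imp_eq_add_vec[OF mult_mat_vec_carrier[OF Gc cc] vec_integral_carrier])
    then have eq: "c0 @\<^sub>v c1 = mat_inv Ghat *\<^sub>v ((0\<^sub>v ?k @\<^sub>v ?v0) + ?I)"
      using assoc_mult_mat_vec[OF Gi(1) Gc cc] Gi(3) cc by simp
    have "op_D a b n m F3 u = (?v0, w)" by (simp add: op_D_def w_def)
    have "AE x in ?M. u x = op_T a b n m Ghat Hhat (op_D a b n m F3 u) x"
      using ae AE_space
    proof eventually_elim
      case (elim x)
      then have x: "x \<in> {a..b}" by simp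
      show ?case
        unfolding \<open>op_D a b n m F3 u = (?v0, w)\<close> elim(1)
        by (rule op_T_eq[OF assms(1) x Gi(1) Hc r(2) w assms(3) vec_integral_carrier c eq, symmetric])
    qed
    with Y show ?thesis ..
  qed
  moreover have "op_T a b n m Ghat Hhat v \<in> space_X a b n E F \<and>
      fst v = fst (op_D a b n m F3 (op_T a b n m Ghat Hhat v)) \<and>
      (AE x in ?M. snd v x = snd (op_D a b n m F3 (op_T a b n m Ghat Hhat v)) x)"
    if vY: "v \<in> space_Y a b n m E2 F2" for v
  proof -
    obtain v0 w where v: "v = (v0, w)" by (cases v)
    have v0: "v0 \<in> carrier_vec m" and w: "w \<in> L2_vec a b n"
      and Y: "vec_integral m a b (\<lambda>x. H_mat b n E2 F2 x *\<^sub>v w x) = 0\<^sub>v m"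
      using vY by (auto simp: v space_Y_def)
    let ?I = "vec_integral (2 * n) a b (\<lambda>x. Hhat x *\<^sub>v w x)"
    let ?r = "(0\<^sub>v ?k @\<^sub>v v0) + ?I"
    have z0: "0\<^sub>v ?k @\<^sub>v v0 \<in> carrier_vec (2 * n)"
      using append_carrier_vec[OF zero_carrier_vec[of ?k] v0] unfolding km .
    then have rr: "?r \<in> carrier_vec (2 * n)" by simp
    let ?c = "mat_inv Ghat *\<^sub>v ?r"
    \<comment> \<open>The only possible initial data: the solution of the augmented system for the
      given (v0, w), cut into value and slope.\<close>
    define c0 c1 where "c0 = vec_first ?c n" and "c1 = vec_last ?c n"
    have c: "c0 \<in> carrier_vec n" "c1 \<in> carrier_vec n" by (simp_all add: c0_def c1_def)
    have eq: "c0 @\<^sub>v c1 = ?c"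
      unfolding c0_def c1_def
      by (rule vec_first_last_append) (use mult_mat_vec_carrier[OF Gi(1) rr] in \<open>simp add: mult_2\<close>)
    note r = res[OF w c]
    define u where "u = op_T a b n m Ghat Hhat v"
    have u: "u x = ?pr c0 c1 w x" if x: "x \<in> {a..b}" for x
      unfolding u_def v
      by (rule op_T_eq[OF assms(1) x Gi(1) Hc r(2) w assms(3) v0 c eq])
    then have ae: "AE x in ?M. u x = ?pr c0 c1 w x" by (intro AE_I2) simp
    have uW: "u \<in> W2 a b n" by (rule W2_primitive2_vec[OF assms(1) w u])
    then have uL: "u \<in> L2_vec a b n" by (simp add: W2_def)
    have Gc_eq: "Ghat *\<^sub>v (c0 @\<^sub>v c1) = ?r"
      unfolding eq using assoc_mult_mat_vec[OF Gc Gi(1) rr] Gi(2) rr by simp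
    \<comment> \<open>With this choice of (c0, c1) the augmented residual equals (0, v0): the upper
      rows give the (E1, F1) constraint, the lower rows recover v0.\<close>
    have "residual a b ?k E1 F1 (?val c0 c1 w) (?pr c0 c1 w) @\<^sub>v vec_integral m a b (\<lambda>x. F3 x *\<^sub>v ?pr c0 c1 w x)
        = 0\<^sub>v ?k @\<^sub>v v0"
      unfolding r(3)[symmetric] r(1) Gc_eq
      by (rule add_diff_cancel_right_vec[OF z0 vec_integral_carrier])
    then have r1: "residual a b ?k E1 F1 (?val c0 c1 w) (?pr c0 c1 w) = 0\<^sub>v ?k"
      and r3: "vec_integral m a b (\<lambda>x. F3 x *\<^sub>v ?pr c0 c1 w x) = v0"
      using append_vec_eq[OF rc[OF assms(8)] zero_carrier_vec] by blast+
    have r2: "residual a b m E2 F2 (?val c0 c1 w) (?pr c0 c1 w) = 0\<^sub>v m"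
      unfolding r(4) Y by (rule eq_vecI) auto
    \<comment> \<open>J sends this residual to the stacked residuals \<open>r1\<close> and
      \<open>r2\<close>, both zero; injectivity of J returns to the original constraint of
      X.\<close>
    have "residual a b (2 * n) E F (?val c0 c1 w) (?pr c0 c1 w) = 0\<^sub>v (2 * n)"
      by (rule invertible_mat_mult_eq_0[OF assms(6,7) rc[OF assms(4)]]) (simp only: r(5) r1 r2 zz)
    then have "E *\<^sub>v boundary_values a b n u + vec_integral (2 * n) a b (\<lambda>x. F x *\<^sub>v u x) = 0\<^sub>v (2 * n)"
      unfolding residual_def AE_eq_primitive2_vec(1)[OF assms(1) w ae]
        vec_integral_mult_cong_AE[OF assms(5) uL ae] .
    then have "u \<in> space_X a b n E F" using uW assms(4) by (simp add: space_X_def)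
    moreover have "v0 = fst (op_D a b n m F3 u)"
      using r3 unfolding op_D_def vec_integral_mult_cong_AE[OF assms(16) uL ae] by simp
    moreover have "AE x in ?M. w x = snd (op_D a b n m F3 u) x"
      using AE_eq_primitive2_vec(2)[OF assms(1) w ae] by eventually_elim (simp add: op_D_def)
    ultimately show ?thesis unfolding v u_def fst_conv snd_conv by (intro conjI)
  qed
  ultimately show ?thesis by blast
qed

end
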